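(* Let $r_1,r_2>0$ be real and let $X=(S^1,c_{r_1})\vee (S^1,c_{r_2})$. Then \[H_1(X)\cong\begin{cases} \mathbb{Z}\oplus \mathbb{Z},& \text{if } r_1,r_2<\frac{1}{3},\\ \mathbb{Z},& \text{if } r_i<\frac{1}{3} \text{ and } r_j\ge \frac{1}{2} \text{ for some } \{i,j\}=\{1,2\},\\ 0,& \text{if } r_1,r_2\ge \frac{1}{2}. \end{cases}\]
   Context: A (Čech) closure space is a pair $(X,c)$ of a set $X$ and a function $c:2^X\to 2^X$ with $c(\varnothing)=\varnothing$, $A\subset c(A)$, and $c(A\cup B)=c(A)\cup c(B)$ for all $A,B\subset X$. Topological spaces are the closure spaces with $c(c(A))=c(A)$ for all $A$, where $c$ is the topological closure. A map $f:(X,c)\to(Y,d)$ is continuous if $f(c(A))\subset d(f(A))$ for all $A\subset X$. $S^1$ is the circle with geodesic metric $d$ and circumference $1$ (i.e. $\mathbb{R}/\mathbb{Z}$ with its quotient metric). For $A\subset S^1$ nonempty, $c_r(A)=\{x\in S^1 : \inf_{y\in A}d(x,y)\le r\}$, and $c_r(\varnothing)=\varnothing$. The wedge sum $(X_1,c_1)\vee(X_2,c_2)$ is the quotient of the disjoint union $X_1\sqcup X_2$, with closure $c(A_1\sqcup A_2)=c_1(A_1)\sqcup c_2(A_2)$, by the identification of chosen basepoints $x_1\in X_1$, $x_2\in X_2$; with quotient map $q$, its closure is $A\mapsto q(c(q^{-1}(A)))$. Singular homology: let $|\Delta^n|=\{(t_0,\dots,t_n)\in\mathbb{R}^{n+1}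 : \sum_i t_i=1,\ t_i\ge 0\}=[e_0,\dots,e_n]$ with the Euclidean topology. $C_n(X)$ is the free abelian group on continuous maps $\sigma:|\Delta^n|\to X$ (and $C_n(X)=0$ for $n<0$), $\partial_n(\sigma)=\sum_{i=0}^n(-1)^i\sigma|_{[e_0,\dots,\hat e_i,\dots,e_n]}$, and $H_n(X)=\ker\partial_n/\operatorname{im}\partial_{n+1}$. *)

theory Defs
  imports "HOL-Homology.Homology"
begin

section \<open>Closure spaces\<close>

text \<open>The closure operator of a space with point set \<open>X\<close> is a total function on
  \<open>'a set\<close>; only its values on subsets of \<open>X\<close> are meaningful.\<close>

record 'a cspace =
  points :: "'a set"
  clos :: "'a set \<Rightarrow> 'a set"

definition closure_space :: "'a cspace \<Rightarrow> bool" where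
  "closure_space X \<longleftrightarrow>
     clos X {} = {} \<and>
     (\<forall>A. A \<subseteq> points X \<longrightarrow> A \<subseteq> clos X A \<and> clos X A \<subseteq> points X) \<and>
     (\<forall>A B. A \<subseteq> points X \<longrightarrow> B \<subseteq> points X \<longrightarrow> clos X (A \<union> B) = clos X A \<union> clos X B)"

definition cs_continuous :: "'a cspace \<Rightarrow> 'b cspace \<Rightarrow> ('a \<Rightarrow> 'b) \<Rightarrow> bool" where
  "cs_continuous X Y f \<longleftrightarrow>
     f ` points X \<subseteq> points Y \<and> (\<forall>A. A \<subseteq> points X \<longrightarrow> f ` clos X A \<subseteq> clos Y (f ` A))"

definition cspace_of_topology :: "'a topology \<Rightarrow> 'a cspace" where
  "cspace_of_topology T = \<lparr>points = topspace T, clos = (\<lambda>A. T closure_of A)\<rparr>"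

lemma closure_space_of_topology: "closure_space (cspace_of_topology T)"
  by (auto simp: closure_space_def cspace_of_topology_def closure_of_subset closure_of_Un
      dest: subsetD[OF closure_of_subset_topspace])

lemma cs_continuous_of_topology:
  "cs_continuous (cspace_of_topology S) (cspace_of_topology T) f \<longleftrightarrow> continuous_map S T f"
proof
  assume L: "cs_continuous (cspace_of_topology S) (cspace_of_topology T) f"
  show "continuous_map S T f"
    unfolding continuous_map_eq_image_closure_subset image_subset_iff_funcset [symmetric]
  proof (intro allI)
    fix A
    have "f ` (S closure_of (topspace S \<inter> A)) \<subseteq> T closure_of (f ` (topspace S \<inter> A))"
      using L by (auto simp: cs_continuous_def cspace_of_topology_def)
    also have "\<dots> \<subseteq> T closure_of (f ` A)"
      by (intro closure_of_mono) auto
    finally show "f ` (S closure_of A) \<subseteq> T closure_of (f ` A)"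
      using closure_of_restrict[of S A] by simp
  qed
next
  assume "continuous_map S T f"
  then show "cs_continuous (cspace_of_topology S) (cspace_of_topology T) f"
    using continuous_map_image_subset_topspace[of S T f]
    by (auto simp: cs_continuous_def cspace_of_topology_def continuous_map_eq_image_closure_subset)
qed


section \<open>The circle of circumference 1 with the closure \<open>c\<^sub>r\<close>\<close>

text \<open>Points of \<open>\<real>/\<int>\<close> are the cosets \<open>x + \<int>\<close>.  The quotient metric is the
  infimum of the distances between representatives, which is \<^const>\<open>setdist\<close>.\<close>

definition circle :: "real set set" where
  "circle = UNIV // {(x, y). x - y \<in> \<int>}"

definition circle_closure :: "real \<Rightarrow> real set set \<Rightarrow> real set set" where
  "circle_closure r A = (if A = {} then {} else {x \<in> circle. (INF y\<in>A. setdist x y) \<le> r})"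

definition circle_cspace :: "real \<Rightarrow> real set cspace" where
  "circle_cspace r = \<lparr>points = circle, clos = circle_closure r\<rparr>"

lemma closure_space_circle:
  assumes "0 \<le> r"
  shows "closure_space (circle_cspace r)"
proof -
  have bdd: "bdd_below ((\<lambda>y. setdist x y) ` A)" for x :: "real set" and A
    by (rule bdd_belowI[of _ 0]) (auto simp: setdist_pos_le)
  have "A \<subseteq> circle_closure r A" if "A \<subseteq> circle" for A
  proof
    fix x assume x: "x \<in> A"
    then have "(INF y\<in>A. setdist x y) \<le> setdist x x"
      by (intro cINF_lower bdd)
    also have "\<dots> \<le> r"
      using assms by (simp add: setdist_refl)
    finally show "x \<in> circle_closure r A"
      using x that unfolding circle_closure_def by (simp add: subset_iff) blast
  qed
  moreover have "circle_closure r (A \<union> B) = circle_closure r A \<union> circle_closure r B" for A B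
  proof (cases "A = {} \<or> B = {}")
    case True
    then show ?thesis by (auto simp: circle_closure_def)
  next
    case False
    then have "(INF y\<in>A \<union> B. setdist x y) = inf (INF y\<in>A. setdist x y) (INF y\<in>B. setdist x y)" for x
      by (intro cINF_union bdd) auto
    then show ?thesis
      using False by (auto simp: circle_closure_def inf_real_def min_le_iff_disj)
  qed
  moreover have "circle_closure r A \<subseteq> circle" "circle_closure r {} = {}" for A
    by (auto simp: circle_closure_def)
  ultimately show ?thesis
    unfolding closure_space_def circle_cspace_def cspace.simps by (intro conjI allI impI)
qed


section \<open>Disjoint unions, quotients and wedge sums\<close>

definition cs_sum :: "'a cspace \<Rightarrow> 'b cspace \<Rightarrow> ('a + 'b) cspace" where
  "cs_sum X Y = \<lparr>points = Inl ` points X \<union> Inr ` points Y,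
     clos = (\<lambda>A. Inl ` clos X (Inl -` A) \<union> Inr ` clos Y (Inr -` A))\<rparr>"

text \<open>The quotient by an equivalence relation \<open>R\<close>, with quotient map
  \<open>q x = R `` {x}\<close> and closure \<open>A \<mapsto> q (c (q\<^sup>-\<^sup>1 A))\<close>.\<close>

definition cs_quotient :: "'a cspace \<Rightarrow> ('a \<times> 'a) set \<Rightarrow> 'a set cspace" where
  "cs_quotient X R =
     (let q = (\<lambda>x. R `` {x})
      in \<lparr>points = points X // R, clos = (\<lambda>A. q ` clos X {x \<in> points X. q x \<in> A})\<rparr>)"

definition wedge_rel :: "'a cspace \<Rightarrow> 'a \<Rightarrow> 'b cspace \<Rightarrow> 'b \<Rightarrow> (('a + 'b) \<times> ('a + 'b)) set" where
  "wedge_rel X x Y y =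
     Id_on (Inl ` points X \<union> Inr ` points Y) \<union> {(Inl x, Inr y), (Inr y, Inl x)}"

definition cs_wedge :: "'a cspace \<Rightarrow> 'a \<Rightarrow> 'b cspace \<Rightarrow> 'b \<Rightarrow> ('a + 'b) set cspace" where
  "cs_wedge X x Y y = cs_quotient (cs_sum X Y) (wedge_rel X x Y y)"

lemma closure_space_sum:
  assumes "closure_space X" "closure_space Y"
  shows "closure_space (cs_sum X Y)"
proof -
  have sub: "Inl -` A \<subseteq> points X \<and> Inr -` A \<subseteq> points Y" if "A \<subseteq> Inl ` points X \<union> Inr ` points Y" for A
    using that by auto
  show ?thesis
    unfolding closure_space_def
  proof (intro conjI allI impI)
    show "clos (cs_sum X Y) {} = {}"
      using assms by (simp add: closure_space_def cs_sum_def)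
  next
    fix A assume "A \<subseteq> points (cs_sum X Y)"
    then have A: "A \<subseteq> Inl ` points X \<union> Inr ` points Y" by (simp add: cs_sum_def)
    have 1: "Inl -` A \<subseteq> clos X (Inl -` A)" "clos X (Inl -` A) \<subseteq> points X"
      "Inr -` A \<subseteq> clos Y (Inr -` A)" "clos Y (Inr -` A) \<subseteq> points Y"
      using assms sub[OF A] unfolding closure_space_def by simp_all
    show "A \<subseteq> clos (cs_sum X Y) A"
    proof
      fix z assume "z \<in> A"
      then show "z \<in> clos (cs_sum X Y) A"
        using 1(1,3) by (cases z) (auto simp: cs_sum_def subset_iff)
    qed
    show "clos (cs_sum X Y) A \<subseteq> points (cs_sum X Y)"
      using 1 by (auto simp: cs_sum_def)
  next
    fix A B assume "A \<subseteq> points (cs_sum X Y)" "B \<subseteq> points (cs_sum X Y)"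
    then have AB: "A \<subseteq> Inl ` points X \<union> Inr ` points Y" "B \<subseteq> Inl ` points X \<union> Inr ` points Y"
      by (simp_all add: cs_sum_def)
    have "clos X (Inl -` A \<union> Inl -` B) = clos X (Inl -` A) \<union> clos X (Inl -` B)"
      "clos Y (Inr -` A \<union> Inr -` B) = clos Y (Inr -` A) \<union> clos Y (Inr -` B)"
      using assms sub[OF AB(1)] sub[OF AB(2)] by (simp_all add: closure_space_def)
    then show "clos (cs_sum X Y) (A \<union> B) = clos (cs_sum X Y) A \<union> clos (cs_sum X Y) B"
      by (auto simp: cs_sum_def vimage_Un)
  qed
qed

lemma closure_space_quotient:
  assumes X: "closure_space X" and R: "equiv (points X) R"
  shows "closure_space (cs_quotient X R)"
proof -
  define q where "q = (\<lambda>x. R `` {x})"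
  define p where "p = (\<lambda>A. {x \<in> points X. q x \<in> A})"
  have pts: "points (cs_quotient X R) = q ` points X"
    by (auto simp: cs_quotient_def q_def quotient_def)
  have clo: "clos (cs_quotient X R) A = q ` clos X (p A)" for A
    by (simp add: cs_quotient_def q_def p_def)
  have p: "p A \<subseteq> points X" "p (A \<union> B) = p A \<union> p B" "p {} = {}" for A B
    by (auto simp: p_def)
  have c: "p A \<subseteq> clos X (p A)" "clos X (p A) \<subseteq> points X"
    "clos X (p A \<union> p B) = clos X (p A) \<union> clos X (p B)" "clos X {} = {}" for A B
    using X p(1) unfolding closure_space_def by simp_all
  have "A \<subseteq> q ` clos X (p A)" if "A \<subseteq> q ` points X" for A
    using that c(1)[of A] by (auto simp: p_def)
  then show ?thesis
    unfolding closure_space_def pts clo p(2,3) c(3,4)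
    using c(2) by (simp add: image_Un image_mono)
qed

lemma equiv_wedge_rel:
  assumes "x \<in> points X" "y \<in> points Y"
  shows "equiv (Inl ` points X \<union> Inr ` points Y) (wedge_rel X x Y y)"
  using assms
  by (intro equivI refl_onI symI transI) (auto simp: wedge_rel_def)

lemma closure_space_wedge:
  assumes "closure_space X" "closure_space Y" "x \<in> points X" "y \<in> points Y"
  shows "closure_space (cs_wedge X x Y y)"
  unfolding cs_wedge_def
  using equiv_wedge_rel[OF assms(3,4)]
  by (intro closure_space_quotient closure_space_sum assms) (simp add: cs_sum_def)


section \<open>Singular homology of closure spaces\<close>

text \<open>The faces and the boundary map of the library's singular homology do not mention the
  target space, so \<^const>\<open>chain_boundary\<close> serves here unchanged.  As there, simplices are
  functions that are \<^const>\<open>undefined\<close> off the standard simplex.\<close>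

definition cs_simplex :: "nat \<Rightarrow> 'a cspace \<Rightarrow> ((nat \<Rightarrow> real) \<Rightarrow> 'a) \<Rightarrow> bool" where
  "cs_simplex n X f \<longleftrightarrow>
     cs_continuous
       (cspace_of_topology (subtopology (powertop_real UNIV) (standard_simplex n))) X f \<and>
     f \<in> extensional (standard_simplex n)"

definition cs_chain_group :: "nat \<Rightarrow> 'a cspace \<Rightarrow> 'a chain monoid" where
  "cs_chain_group n X = free_Abelian_group (Collect (cs_simplex n X))"

text \<open>In degree 0 every chain is a cycle, because \<open>chain_boundary 0\<close> is the zero map.\<close>

definition cs_cycles :: "nat \<Rightarrow> 'a cspace \<Rightarrow> 'a chain set" where
  "cs_cycles n X = {c \<in> carrier (cs_chain_group n X). chain_boundary n c = 0}"

definition cs_boundaries :: "nat \<Rightarrow> 'a cspace \<Rightarrow> 'a chain set" where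
  "cs_boundaries n X = chain_boundary (Suc n) ` carrier (cs_chain_group (Suc n) X)"

definition cs_homology_group :: "nat \<Rightarrow> 'a cspace \<Rightarrow> 'a chain set monoid" where
  "cs_homology_group n X =
     subgroup_generated (cs_chain_group n X) (cs_cycles n X) Mod cs_boundaries n X"

lemma cs_simplex_of_topology:
  "cs_simplex n (cspace_of_topology T) f \<longleftrightarrow> singular_simplex n T f"
  by (simp add: cs_simplex_def singular_simplex_def cs_continuous_of_topology)

end

theory Submission
  imports Defs
begin

text \<open>Two parts bound the first homology of the wedge from both sides.

\<^emph>\<open>Generation.\<close>  Each summand is covered by a line \<open>iota k\<close>, and a map into the wedge is
continuous exactly when the jumps near each point stay below \<open>r k + e\<close> in a suitable coordinate, for
every \<open>e > 0\<close> (\<open>continuous_into_iff\<close>).  A short piece of a path therefore lies in the star of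
one of its points.  Scaling the coordinate contracts such a star linearly, so the piece is
homologous to a difference of two standard paths (\<open>star_piece\<close>).  Bisecting the parameter interval
extends this to all paths: a 1-cycle is homologous to a combination of the two loops
(\<open>cycle_in_loop_span\<close>).  The star at the basepoint contains arcs of both circles, and it is
contracted in the same way.  If \<open>r k \<ge> 1/2\<close> the circle \<open>k\<close> is
indiscrete, arbitrary maps into it are continuous, and its loop bounds
(\<open>loop_boundary_of_large_radius\<close>).

\<^emph>\<open>Independence.\<close>  If \<open>r k < 1/3\<close>, the jumps of a continuous map into circle \<open>k\<close> can be chosen
smaller than \<open>1/3\<close>.  Three jumps of this size around a triangle cannot sum to a nonzero integer, so
the line is a covering of the circle as far as simplices are concerned: local lifts to the line are
forced up to an integer and glue over a convex compact plane set (\<open>lifts_exists_plane\<close>).  The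
increment of a lift along the edges of a singular triangle sums to zero, so the winding number
is defined on homology (\<open>winding_number_boundary\<close>), and it is \<open>1\<close> on the loop \<open>k\<close> and
\<open>0\<close> on the other loop.

Hence the winding numbers around the circles with \<open>r k < 1/3\<close> map the cycles onto a free
abelian group, and the kernel consists of the boundaries.  The restriction that no radius lies in
\<open>[1/3, 1/2)\<close> enters on both sides: in that range a star need not contract linearly and a triangle
can wind around the circle.\<close>


section \<open>Affine simplices in a closure space\<close>

lemma cs_continuous_compose:
  assumes "cs_continuous X Y f" "cs_continuous Y Z g"
  shows "cs_continuous X Z (g \<circ> f)"
  unfolding cs_continuous_def
proof (intro conjI allI impI)
  show "(g \<circ> f) ` points X \<subseteq> points Z"
    using assms unfolding cs_continuous_def by fastforce
  fix A assume A: "A \<subseteq> points X"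
  then have "f ` A \<subseteq> points Y"
    using assms by (auto simp: cs_continuous_def)
  then have "g ` clos Y (f ` A) \<subseteq> clos Z (g ` f ` A)"
    using assms by (auto simp: cs_continuous_def)
  moreover have "f ` clos X A \<subseteq> clos Y (f ` A)"
    using assms A by (auto simp: cs_continuous_def)
  ultimately show "(g \<circ> f) ` clos X A \<subseteq> clos Z ((g \<circ> f) ` A)"
    unfolding image_comp [symmetric] by blast
qed

lemma cs_continuous_cong:
  assumes "cs_continuous (cspace_of_topology T) X f" and eq: "\<And>x. x \<in> topspace T \<Longrightarrow> f x = g x"
  shows "cs_continuous (cspace_of_topology T) X g"
proof -
  have "g ` A = f ` A" if "A \<subseteq> topspace T" for A
    using that eq by (auto simp: image_def subset_iff)
  then show ?thesis
    using assms(1) closure_of_subset_topspace[of T]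
    by (simp add: cs_continuous_def cspace_of_topology_def)
qed

abbreviation continuous_into :: "'a::topological_space set \<Rightarrow> 'p cspace \<Rightarrow> ('a \<Rightarrow> 'p) \<Rightarrow> bool" where
  "continuous_into D X F \<equiv> cs_continuous (cspace_of_topology (top_of_set D)) X F"

abbreviation simplex_topology :: "nat \<Rightarrow> (nat \<Rightarrow> real) topology" where
  "simplex_topology n \<equiv> subtopology (powertop_real UNIV) (standard_simplex n)"

lemma continuous_into_compose:
  assumes "continuous_into D X F" "continuous_on S h" "h ` S \<subseteq> D"
  shows "continuous_into S X (F \<circ> h)"
  using assms
  by (intro cs_continuous_compose[OF _ assms(1)]) (auto simp: cs_continuous_of_topology)

text \<open>The map \<open>F\<close> is defined on a vector space, so that a single domain carries all the simplices used
in an argument and their faces match literally.\<close>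

definition seg :: "('a::real_vector \<Rightarrow> 'p) \<Rightarrow> 'a \<Rightarrow> 'a \<Rightarrow> (nat \<Rightarrow> real) \<Rightarrow> 'p" where
  "seg F p q = restrict (\<lambda>t. F (t 0 *\<^sub>R p + t 1 *\<^sub>R q)) (standard_simplex 1)"

definition tri :: "('a::real_vector \<Rightarrow> 'p) \<Rightarrow> 'a \<Rightarrow> 'a \<Rightarrow> 'a \<Rightarrow> (nat \<Rightarrow> real) \<Rightarrow> 'p" where
  "tri F p q r = restrict (\<lambda>t. F (t 0 *\<^sub>R p + t 1 *\<^sub>R q + t 2 *\<^sub>R r)) (standard_simplex 2)"

lemma standard_simplex_1_iff:
  "t \<in> standard_simplex 1 \<longleftrightarrow> 0 \<le> t 0 \<and> 0 \<le> t 1 \<and> t 0 + t 1 = 1 \<and> (\<forall>i>1. t i = 0)"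
proof -
  have "0 \<le> t i \<and> t i \<le> 1" if "0 \<le> t 0" "0 \<le> t 1" "t 0 + t 1 = 1" "\<forall>i>1. t i = 0" for i
    using that by (cases "i = 0"; cases "i = 1") auto
  then show ?thesis by (auto simp: standard_simplex_def)
qed

lemma standard_simplex_2_iff:
  "t \<in> standard_simplex 2 \<longleftrightarrow>
     0 \<le> t 0 \<and> 0 \<le> t 1 \<and> 0 \<le> t 2 \<and> t 0 + t 1 + t 2 = 1 \<and> (\<forall>i>2. t i = 0)"
proof -
  have "0 \<le> t i \<and> t i \<le> 1"
    if "0 \<le> t 0" "0 \<le> t 1" "0 \<le> t 2" "t 0 + t 1 + t 2 = 1" "\<forall>i>2. t i = 0" for i
    using that by (cases "i = 0"; cases "i = 1"; cases "i = 2") auto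
  then show ?thesis by (auto simp: standard_simplex_def numeral_2_eq_2)
qed

lemma continuous_map_simplexI:
  fixes h :: "(nat \<Rightarrow> real) \<Rightarrow> 'a::topological_space"
  assumes "continuous_on UNIV h"
  shows "continuous_map (simplex_topology n) euclidean h"
  using assms
  by (intro continuous_map_from_subtopology) (simp add: euclidean_product_topology)

lemma convex_combination3:
  fixes p q r :: "'a::real_vector"
  assumes "convex D" "p \<in> D" "q \<in> D" "r \<in> D" "0 \<le> a" "0 \<le> b" "0 \<le> c" "a + b + c = (1::real)"
  shows "a *\<^sub>R p + b *\<^sub>R q + c *\<^sub>R r \<in> D"
proof -
  have "a *\<^sub>R p + b *\<^sub>R q + c *\<^sub>R r \<in> convex hull {p, q, r}"
    using assms(5-) by (auto simp: convex_hull_3)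
  also have "\<dots> \<subseteq> D"
    using assms by (simp add: subset_hull)
  finally show ?thesis .
qed

lemma cs_simplex_tri:
  fixes p q r :: "'a::real_normed_vector"
  assumes F: "continuous_into D X F" and "convex D" "p \<in> D" "q \<in> D" "r \<in> D"
  shows "cs_simplex 2 X (tri F p q r)"
proof -
  let ?h = "\<lambda>t::nat\<Rightarrow>real. t 0 *\<^sub>R p + t 1 *\<^sub>R q + t 2 *\<^sub>R r"
  have "continuous_map (simplex_topology 2) euclidean ?h"
    by (intro continuous_map_simplexI continuous_intros continuous_on_product_coordinates)
  moreover have "?h t \<in> D" if "t \<in> standard_simplex 2" for t
    using that assms by (intro convex_combination3) (auto simp: standard_simplex_2_iff)
  ultimately have "continuous_map (simplex_topology 2) (top_of_set D) ?h"
    by (auto simp: continuous_map_in_subtopology)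
  then have "cs_continuous (cspace_of_topology (simplex_topology 2)) X (F \<circ> ?h)"
    by (intro cs_continuous_compose[OF _ F]) (simp add: cs_continuous_of_topology)
  then have "cs_continuous (cspace_of_topology (simplex_topology 2)) X (tri F p q r)"
    by (rule cs_continuous_cong) (auto simp: tri_def)
  then show ?thesis
    by (simp add: cs_simplex_def tri_def)
qed

lemma cs_simplex_seg:
  fixes p q :: "'a::real_normed_vector"
  assumes F: "continuous_into D X F" and "convex D" "p \<in> D" "q \<in> D"
  shows "cs_simplex 1 X (seg F p q)"
proof -
  let ?h = "\<lambda>t::nat\<Rightarrow>real. t 0 *\<^sub>R p + t 1 *\<^sub>R q"
  have "continuous_map (simplex_topology 1) euclidean ?h"
    by (intro continuous_map_simplexI continuous_intros continuous_on_product_coordinates)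
  moreover have "?h t \<in> D" if "t \<in> standard_simplex 1" for t
    using that convexD[OF assms(2-4), of "t 0" "t 1"] unfolding standard_simplex_1_iff by auto
  ultimately have "continuous_map (simplex_topology 1) (top_of_set D) ?h"
    by (auto simp: continuous_map_in_subtopology)
  then have "cs_continuous (cspace_of_topology (simplex_topology 1)) X (F \<circ> ?h)"
    by (intro cs_continuous_compose[OF _ F]) (simp add: cs_continuous_of_topology)
  then have "cs_continuous (cspace_of_topology (simplex_topology 1)) X (seg F p q)"
    by (rule cs_continuous_cong) (auto simp: seg_def)
  then show ?thesis
    by (simp add: cs_simplex_def seg_def)
qed

lemma singular_face_tri:
  "singular_face 2 0 (tri F p q r) = seg F q r"
  "singular_face 2 1 (tri F p q r) = seg F p r"
  "singular_face 2 2 (tri F p q r) = seg F p q"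
proof -
  have *: "simplical_face k t \<in> standard_simplex 2" if "k \<le> 2" "t \<in> standard_simplex 1" for k t
    using simplical_face_in_standard_simplex[of 2 k t] that by simp
  have 0: "t (Suc 0) = t 1" for t :: "nat \<Rightarrow> real" by simp
  show "singular_face 2 0 (tri F p q r) = seg F q r"
    "singular_face 2 1 (tri F p q r) = seg F p r"
    "singular_face 2 2 (tri F p q r) = seg F p q"
    by (auto simp: singular_face_def seg_def tri_def fun_eq_iff restrict_def *)
       (auto simp: simplical_face_def)
qed

lemma chain_boundary_2:
  "chain_boundary 2 (frag_of \<tau>)
    = frag_of (singular_face 2 0 \<tau>) - frag_of (singular_face 2 1 \<tau>) + frag_of (singular_face 2 2 \<tau>)"
proof -
  have "{..2::nat} = {0, 1, 2}" by auto
  then show ?thesis by (simp add: chain_boundary_of)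
qed

lemma chain_boundary_seg:
  "chain_boundary 1 (frag_of (seg F p q))
    = frag_of (restrict (\<lambda>_. F q) (standard_simplex 0)) - frag_of (restrict (\<lambda>_. F p) (standard_simplex 0))"
proof -
  have "{..1::nat} = {0, 1}" by auto
  moreover
  have *: "simplical_face k t \<in> standard_simplex (Suc 0)" if "k \<le> 1" "t \<in> standard_simplex 0" for k t
    using simplical_face_in_standard_simplex[of 1 k t] that by simp
  have "singular_face 1 0 (seg F p q) = restrict (\<lambda>_. F q) (standard_simplex 0)"
    "singular_face 1 1 (seg F p q) = restrict (\<lambda>_. F p) (standard_simplex 0)"
    using *[of 0] *[of 1]
    by (auto simp: singular_face_def seg_def fun_eq_iff restrict_def simplical_face_def)
       (auto simp: standard_simplex_0)
  ultimately show ?thesis by (simp add: chain_boundary_of)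
qed

text \<open>Parametrises the standard 1-simplex by the unit interval, so that a singular 1-simplex becomes a
path on a real interval that can be cut into pieces.\<close>

definition edge :: "real \<Rightarrow> nat \<Rightarrow> real" where
  "edge s = (\<lambda>i. if i = 0 then 1 - s else if i = 1 then s else 0)"

lemma edge_in_simplex: "0 \<le> s \<Longrightarrow> s \<le> 1 \<Longrightarrow> edge s \<in> standard_simplex 1"
  unfolding standard_simplex_1_iff by (simp add: edge_def)

lemma simplex_1_eq_seg:
  assumes "cs_simplex 1 X \<sigma>"
  shows "\<sigma> = seg (\<sigma> \<circ> edge) 0 1"
proof
  fix t
  show "\<sigma> t = seg (\<sigma> \<circ> edge) 0 1 t"
  proof (cases "t \<in> standard_simplex 1")
    case True
    then have "edge (t 1) = t"
      unfolding standard_simplex_1_iff by (auto simp: edge_def fun_eq_iff)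
    then show ?thesis using True by (simp add: seg_def)
  next
    case False
    then show ?thesis
      using assms by (auto simp: cs_simplex_def seg_def extensional_def)
  qed
qed

lemma continuous_map_into_simplex:
  fixes h :: "'a::topological_space \<Rightarrow> nat \<Rightarrow> real"
  assumes "\<And>i. continuous_on S (\<lambda>x. h x i)" "\<And>x. x \<in> S \<Longrightarrow> h x \<in> standard_simplex n"
  shows "continuous_map (top_of_set S) (simplex_topology n) h"
  using assms by (auto simp: continuous_map_in_subtopology continuous_map_componentwise)

lemma continuous_into_edge:
  assumes "cs_simplex 1 X \<sigma>"
  shows "continuous_into {0..1} X (\<sigma> \<circ> edge)"
proof (rule cs_continuous_compose)
  show "cs_continuous (cspace_of_topology (simplex_topology 1)) X \<sigma>"
    using assms by (simp add: cs_simplex_def)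
  have "continuous_on {0..1} (\<lambda>s. edge s i)" for i
    unfolding edge_def by (cases "i = 0"; cases "i = 1") (auto intro!: continuous_intros)
  then show "cs_continuous (cspace_of_topology (top_of_set {0..1})) (cspace_of_topology (simplex_topology 1)) edge"
    unfolding cs_continuous_of_topology
    by (intro continuous_map_into_simplex) (simp_all del: One_nat_def add: edge_in_simplex)
qed


section \<open>Boundaries and the first homology group\<close>

lemma cs_boundary_of:
  assumes "cs_simplex 2 X \<tau>"
  shows "chain_boundary 2 (frag_of \<tau>) \<in> cs_boundaries 1 X"
  using assms by (auto simp: cs_boundaries_def cs_chain_group_def numeral_2_eq_2)

lemma cs_boundaries_0: "0 \<in> cs_boundaries n X"
  unfolding cs_boundaries_def cs_chain_group_def by (rule image_eqI[of _ _ 0]) auto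

lemma cs_boundaries_diff:
  assumes "b \<in> cs_boundaries n X" "c \<in> cs_boundaries n X"
  shows "b - c \<in> cs_boundaries n X"
proof -
  from assms obtain b' c' where
    "b = chain_boundary (Suc n) b'" "Poly_Mapping.keys b' \<subseteq> Collect (cs_simplex (Suc n) X)"
    "c = chain_boundary (Suc n) c'" "Poly_Mapping.keys c' \<subseteq> Collect (cs_simplex (Suc n) X)"
    by (auto simp: cs_boundaries_def cs_chain_group_def)
  then show ?thesis
    unfolding cs_boundaries_def cs_chain_group_def using keys_diff[of b' c']
    by (intro image_eqI[of _ _ "b' - c'"]) (auto simp: chain_boundary_diff)
qed

lemma diff_closed_imp_add_closed:
  fixes A :: "'a::ab_group_add set"
  assumes "0 \<in> A" "\<And>b c. b \<in> A \<Longrightarrow> c \<in> A \<Longrightarrow> b - c \<in> A" "b \<in> A" "c \<in> A"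
  shows "b + c \<in> A"
  using assms(2)[OF assms(3) assms(2)[OF assms(1,4)]] by simp

lemma cs_boundaries_add:
  assumes "b \<in> cs_boundaries n X" "c \<in> cs_boundaries n X"
  shows "b + c \<in> cs_boundaries n X"
  using diff_closed_imp_add_closed[of "cs_boundaries n X" b c] assms cs_boundaries_0 cs_boundaries_diff
  by blast

lemma cs_boundaries_cmul:
  assumes "b \<in> cs_boundaries n X"
  shows "frag_cmul m b \<in> cs_boundaries n X"
proof -
  from assms obtain b' where
    "b = chain_boundary (Suc n) b'" "Poly_Mapping.keys b' \<subseteq> Collect (cs_simplex (Suc n) X)"
    by (auto simp: cs_boundaries_def cs_chain_group_def)
  then show ?thesis
    unfolding cs_boundaries_def cs_chain_group_def using keys_cmul[of m b']
    by (intro image_eqI[of _ _ "frag_cmul m b'"]) (auto simp: chain_boundary_cmul)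
qed

text \<open>This is the only source of boundaries in the generation argument: subdividing a path, reversing it
and pushing it across a homotopy are all instances, for \<open>F\<close> a path, a line or a homotopy on a strip.\<close>

lemma seg_triangle_boundary:
  fixes p q r :: "'a::real_normed_vector"
  assumes "continuous_into D X F" "convex D" "p \<in> D" "q \<in> D" "r \<in> D"
  shows "frag_of (seg F q r) - frag_of (seg F p r) + frag_of (seg F p q) \<in> cs_boundaries 1 X"
  using cs_boundary_of[OF cs_simplex_tri[OF assms]] chain_boundary_2[of "tri F p q r"]
  unfolding singular_face_tri by simp

lemma cs_chain_induct [consumes 1, case_names zero one diff]:
  assumes "c \<in> carrier (cs_chain_group n X)"
    and "P 0" and "\<And>\<sigma>. cs_simplex n X \<sigma> \<Longrightarrow> P (frag_of \<sigma>)"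
    and "\<And>a b. P a \<Longrightarrow> P b \<Longrightarrow> P (a - b)"
  shows "P c"
  using assms by (intro free_Abelian_group_induct[of c "Collect (cs_simplex n X)" P])
                 (auto simp: cs_chain_group_def)

text \<open>The first isomorphism theorem, stated so that the map \<open>\<phi>\<close> has to be additive on cycles only:
  winding numbers are integers there, but not on general chains.\<close>

lemma cs_homology_group_iso:
  assumes H: "group H"
    and hom: "\<And>c d. c \<in> cs_cycles n X \<Longrightarrow> d \<in> cs_cycles n X \<Longrightarrow> \<phi> (c + d) = \<phi> c \<otimes>\<^bsub>H\<^esub> \<phi> d"
    and onto: "\<phi> ` cs_cycles n X = carrier H"
    and ker: "\<And>c. c \<in> cs_cycles n X \<Longrightarrow> \<phi> c = \<one>\<^bsub>H\<^esub> \<longleftrightarrow> c \<in> cs_boundaries n X"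
    and sub: "cs_boundaries n X \<subseteq> cs_cycles n X"
  shows "cs_homology_group n X \<cong> H" and "group (cs_homology_group n X)"
proof -
  let ?C = "cs_chain_group n X"
  let ?Z = "subgroup_generated ?C (cs_cycles n X)"
  have C: "group ?C" by (simp add: cs_chain_group_def)
  have "subgroup (cs_cycles n X) ?C"
  proof (rule group.subgroupI[OF C])
    show "cs_cycles n X \<subseteq> carrier ?C" by (auto simp: cs_cycles_def)
    have "0 \<in> cs_cycles n X" by (auto simp: cs_cycles_def cs_chain_group_def)
    then show "cs_cycles n X \<noteq> {}" by blast
    show "inv\<^bsub>?C\<^esub> a \<in> cs_cycles n X" if "a \<in> cs_cycles n X" for a
      using that by (auto simp: cs_cycles_def cs_chain_group_def chain_boundary_minus)
    show "a \<otimes>\<^bsub>?C\<^esub> b \<in> cs_cycles n X" if "a \<in> cs_cycles n X" "b \<in> cs_cycles n X" for a b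
      using that keys_add[of a b] by (auto simp: cs_cycles_def cs_chain_group_def chain_boundary_add)
  qed
  then have carrier: "carrier ?Z = cs_cycles n X"
    by (rule subgroup.carrier_subgroup_generated_subgroup)
  have mult: "a \<otimes>\<^bsub>?Z\<^esub> b = a + b" for a b
    by (simp add: cs_chain_group_def)
  interpret group_hom ?Z H \<phi>
  proof (intro group_hom.intro group_hom_axioms.intro homI)
    show "group ?Z" by (intro group.group_subgroup_generated C)
    show "group H" by fact
    show "\<phi> x \<in> carrier H" if "x \<in> carrier ?Z" for x
      using that onto by (auto simp: carrier)
    show "\<phi> (x \<otimes>\<^bsub>?Z\<^esub> y) = \<phi> x \<otimes>\<^bsub>H\<^esub> \<phi> y" if "x \<in> carrier ?Z" "y \<in> carrier ?Z" for x y
      unfolding mult using that hom by (simp add: carrier)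
  qed
  have "kernel ?Z H \<phi> = cs_boundaries n X"
    using ker sub by (auto simp: kernel_def carrier)
  then show "cs_homology_group n X \<cong> H" "group (cs_homology_group n X)"
    using FactGroup_iso onto normal.factorgroup_is_group[OF normal_kernel]
    by (simp_all add: carrier cs_homology_group_def)
qed


section \<open>Lifting maps with small jumps modulo the integers\<close>

text \<open>The function \<open>f\<close> stands for a map to \<open>\<real>/\<int>\<close>, given by arbitrary representatives.  The bound \<open>1/3\<close> is
what makes lifting work: three jumps below \<open>1/3\<close> have a sum below \<open>1\<close>, so that they cannot close up
to a nonzero integer.\<close>

definition small_jumps :: "'a::metric_space set \<Rightarrow> ('a \<Rightarrow> real) \<Rightarrow> bool" where
  "small_jumps S f \<longleftrightarrow>
     (\<forall>x\<in>S. \<exists>d>0. \<forall>y\<in>S. dist x y < d \<longrightarrow> (\<exists>n::int. \<bar>f y - f x - n\<bar> < 1/3))"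

text \<open>A lift may jump too, as long as its jumps stay below \<open>1/3\<close>; this is enough for its uniqueness.\<close>

definition lifts :: "'a::metric_space set \<Rightarrow> ('a \<Rightarrow> real) \<Rightarrow> ('a \<Rightarrow> real) \<Rightarrow> bool" where
  "lifts S f g \<longleftrightarrow>
     (\<forall>x\<in>S. g x - f x \<in> \<int>) \<and> (\<forall>x\<in>S. \<exists>d>0. \<forall>y\<in>S. dist x y < d \<longrightarrow> \<bar>g y - g x\<bar> < 1/3)"

lemma Ints_eq_0: "(x::real) \<in> \<int> \<Longrightarrow> \<bar>x\<bar> < 1 \<Longrightarrow> x = 0"
  by (elim Ints_cases) (auto simp: abs_if split: if_splits)

lemma lifts_subset: "lifts S f g \<Longrightarrow> T \<subseteq> S \<Longrightarrow> lifts T f g"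
  unfolding lifts_def by (meson subset_iff)

lemma lifts_compose:
  assumes G: "lifts S f G" and h: "continuous_on T h" "h ` T \<subseteq> S"
  shows "lifts T (f \<circ> h) (G \<circ> h)"
  unfolding lifts_def
proof (intro conjI ballI)
  fix x assume x: "x \<in> T"
  then have hx: "h x \<in> S" using h(2) by auto
  then show "(G \<circ> h) x - (f \<circ> h) x \<in> \<int>"
    using G by (auto simp: lifts_def)
  from hx G obtain d where d: "d > 0" "\<And>y. y \<in> S \<Longrightarrow> dist (h x) y < d \<Longrightarrow> \<bar>G y - G (h x)\<bar> < 1/3"
    by (auto simp: lifts_def)
  obtain e where "e > 0" "\<And>y. y \<in> T \<Longrightarrow> dist y x < e \<Longrightarrow> dist (h y) (h x) < d"
    using h(1) x d(1) unfolding continuous_on_iff by blast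
  then show "\<exists>e>0. \<forall>y\<in>T. dist x y < e \<longrightarrow> \<bar>(G \<circ> h) y - (G \<circ> h) x\<bar> < 1/3"
    using d(2) h(2) by (intro exI[of _ e]) (auto simp: dist_commute)
qed

text \<open>At nearby points the two lifts each change by less than \<open>1/3\<close>, so their difference, an integer,
cannot change at all.\<close>

lemma lifts_unique:
  assumes "connected S" "lifts S f g" "lifts S f h" "p \<in> S" "q \<in> S"
  shows "g q - h q = g p - h p"
proof (rule connected_local_const[OF assms(1,5,4)], rule ballI)
  fix x assume x: "x \<in> S"
  obtain d where d: "d > 0" "\<And>y. y \<in> S \<Longrightarrow> dist x y < d \<Longrightarrow> \<bar>g y - g x\<bar> < 1/3"
    using assms(2) x by (auto simp: lifts_def)
  obtain e where e: "e > 0" "\<And>y. y \<in> S \<Longrightarrow> dist x y < e \<Longrightarrow> \<bar>h y - h x\<bar> < 1/3"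
    using assms(3) x by (auto simp: lifts_def)
  have "g x - h x = g y - h y" if y: "y \<in> S" "dist y x < min d e" for y
  proof -
    have "g x - f x \<in> \<int>" "h x - f x \<in> \<int>" "g y - f y \<in> \<int>" "h y - f y \<in> \<int>"
      using x y assms(2,3) by (auto simp: lifts_def)
    then have "(g x - f x) - (h x - f x) - ((g y - f y) - (h y - f y)) \<in> \<int>"
      by (metis Ints_diff)
    moreover have "\<bar>g y - g x\<bar> < 1/3" "\<bar>h y - h x\<bar> < 1/3"
      using d(2) e(2) y by (auto simp: dist_commute)
    then have "\<bar>(g x - f x) - (h x - f x) - ((g y - f y) - (h y - f y))\<bar> < 1"
      by linarith
    ultimately have "(g x - f x) - (h x - f x) - ((g y - f y) - (h y - f y)) = 0"
      by (rule Ints_eq_0)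
    then show ?thesis by simp
  qed
  then show "eventually (\<lambda>y. g x - h x = g y - h y) (at x within S)"
    unfolding eventually_at using d(1) e(1) by (intro exI[of _ "min d e"]) auto
qed

text \<open>On the connected overlap the two lifts differ by a constant integer, by which the second one is
shifted.  Closedness keeps a point of one set away from the other set, unless it lies in both.\<close>

lemma lifts_glue:
  fixes f :: "'a::heine_borel \<Rightarrow> real"
  assumes "closed A" "closed B" "connected (A \<inter> B)" and g: "lifts A f g" and h: "lifts B f h"
  shows "\<exists>k. lifts (A \<union> B) f k"
proof -
  obtain c where c: "c \<in> \<int>" "\<And>x. x \<in> A \<inter> B \<Longrightarrow> g x = h x + c"
  proof (cases "A \<inter> B = {}")
    case True
    then show ?thesis using that[of 0] by simp
  next
    case False
    then obtain p where p: "p \<in> A \<inter> B" by blast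
    have "g p - f p \<in> \<int>" "h p - f p \<in> \<int>"
      using p g h by (auto simp: lifts_def)
    then have "(g p - f p) - (h p - f p) \<in> \<int>"
      by (rule Ints_diff)
    moreover have "g x - h x = g p - h p" if "x \<in> A \<inter> B" for x
      using that p g h assms(3) by (intro lifts_unique[of "A \<inter> B" f]) (auto intro: lifts_subset)
    ultimately show ?thesis
      using that[of "g p - h p"] by (auto simp: algebra_simps)
  qed
  define k where "k = (\<lambda>x. if x \<in> A then g x else h x + c)"
  have kA: "k x = g x" if "x \<in> A" for x using that by (simp add: k_def)
  have kB: "k x = h x + c" if "x \<in> B" for x using that c(2) by (auto simp: k_def)
  have A: "\<exists>d>0. \<forall>y\<in>A. dist x y < d \<longrightarrow> \<bar>k y - k x\<bar> < 1/3" for x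
  proof (cases "x \<in> A")
    case True
    then show ?thesis using g by (auto simp: lifts_def kA)
  next
    case False
    then obtain d where "d > 0" "\<And>y. y \<in> A \<Longrightarrow> d \<le> dist x y"
      using separate_point_closed[OF assms(1)] by blast
    then show ?thesis by (intro exI[of _ d]) force
  qed
  have B: "\<exists>d>0. \<forall>y\<in>B. dist x y < d \<longrightarrow> \<bar>k y - k x\<bar> < 1/3" for x
  proof (cases "x \<in> B")
    case True
    then show ?thesis using h by (auto simp: lifts_def kB)
  next
    case False
    then obtain d where "d > 0" "\<And>y. y \<in> B \<Longrightarrow> d \<le> dist x y"
      using separate_point_closed[OF assms(2)] by blast
    then show ?thesis by (intro exI[of _ d]) force
  qed
  have "lifts (A \<union> B) f k"
    unfolding lifts_def
  proof (intro conjI ballI)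
    fix x assume "x \<in> A \<union> B"
    moreover have "h x + c - f x \<in> \<int>" if "x \<in> B"
      using Ints_add[of "h x - f x" c] that h c(1) by (auto simp: lifts_def algebra_simps)
    ultimately show "k x - f x \<in> \<int>"
      using g by (auto simp: kA kB lifts_def)
    from A[of x] B[of x] obtain d e where "d > 0" "e > 0"
      "\<forall>y\<in>A. dist x y < d \<longrightarrow> \<bar>k y - k x\<bar> < 1/3" "\<forall>y\<in>B. dist x y < e \<longrightarrow> \<bar>k y - k x\<bar> < 1/3"
      by blast
    then show "\<exists>d>0. \<forall>y\<in>A \<union> B. dist x y < d \<longrightarrow> \<bar>k y - k x\<bar> < 1/3"
      by (intro exI[of _ "min d e"]) auto
  qed
  then show ?thesis by blast
qed

text \<open>Around \<open>x\<close> the value at \<open>y\<close> is the representative within \<open>1/3\<close> of \<open>f x\<close>.  For two such points \<open>y\<close>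
and \<open>z\<close> that are near each other, the jumps \<open>x \<rightarrow> y \<rightarrow> z \<rightarrow> x\<close> form a triangle, so the jump
from \<open>y\<close> to \<open>z\<close> is the one that the chosen representatives show.\<close>

lemma lifts_local:
  fixes f :: "'a::heine_borel \<Rightarrow> real"
  assumes "small_jumps S f" "closed S"
  shows "\<exists>d>0. \<exists>g. lifts (S \<inter> ball x d) f g"
proof (cases "x \<in> S")
  case False
  then obtain d where "d > 0" "\<And>y. y \<in> S \<Longrightarrow> d \<le> dist x y"
    using separate_point_closed[OF assms(2)] by blast
  then have "S \<inter> ball x d = {}" by force
  then show ?thesis using \<open>d > 0\<close> by (intro exI[of _ d]) (auto simp: lifts_def)
next
  case True
  then obtain d where d: "d > 0" "\<And>y. y \<in> S \<Longrightarrow> dist x y < d \<Longrightarrow> \<exists>n::int. \<bar>f y - f x - n\<bar> < 1/3"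
    using assms(1) unfolding small_jumps_def by blast
  then obtain n :: "'a \<Rightarrow> int"
    where n: "\<And>y. y \<in> S \<Longrightarrow> dist x y < d \<Longrightarrow> \<bar>f y - f x - n y\<bar> < 1/3"
    by metis
  have "lifts (S \<inter> ball x d) f (\<lambda>y. f y - n y)"
    unfolding lifts_def
  proof (intro conjI ballI)
    fix y assume y: "y \<in> S \<inter> ball x d"
    then obtain e where e: "e > 0" "\<And>z. z \<in> S \<Longrightarrow> dist y z < e \<Longrightarrow> \<exists>m::int. \<bar>f z - f y - m\<bar> < 1/3"
      using assms(1) unfolding small_jumps_def by blast
    have "\<bar>(f z - n z) - (f y - n y)\<bar> < 1/3" if z: "z \<in> S \<inter> ball x d" "dist y z < e" for z
    proof -
      obtain m :: int where m: "\<bar>f z - f y - m\<bar> < 1/3" using e(2) z by blast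
      have "\<bar>f z - f x - n z\<bar> < 1/3" "\<bar>f y - f x - n y\<bar> < 1/3" using n y z by auto
      then have "real_of_int (m - n z + n y) = 0"
        using m by (intro Ints_eq_0 Ints_of_int) linarith
      then show ?thesis using m by linarith
    qed
    then show "\<exists>e>0. \<forall>z\<in>S \<inter> ball x d. dist y z < e \<longrightarrow> \<bar>(f z - n z) - (f y - n y)\<bar> < 1/3"
      using e(1) by blast
  qed auto
  then show ?thesis using d(1) by blast
qed

text \<open>Compactness enters through bisection in each direction: first a thin vertical strip around each
abscissa is lifted, then the strips are joined.  Convexity makes the intersections of neighbouring
rectangles with \<open>S\<close> connected, as gluing requires.\<close>

lemma lifts_exists_plane:
  fixes f :: "real \<times> real \<Rightarrow> real"
  assumes f: "small_jumps S f" and S: "closed S" "convex S" "S \<subseteq> {0..1} \<times> {0..1}"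
  shows "\<exists>g. lifts S f g"
proof -
  let ?R = "\<lambda>a b c d. S \<inter> {a..b} \<times> {c..d}"
  have glue: "\<exists>k. lifts (A \<union> B) f k"
    if "A = ?R a b c d" "B = ?R a' b' c' d'" "lifts A f g" "lifts B f h" for A B a b c d a' b' c' d' g h
  proof (rule lifts_glue[OF _ _ _ that(3,4)])
    show "closed A" "closed B"
      unfolding that using S by (auto intro!: closed_Int closed_Times)
    have "convex (A \<inter> B)"
      unfolding that using S by (intro convex_Int convex_Times) auto
    then show "connected (A \<inter> B)" by (rule convex_connected)
  qed
  \<comment> \<open>The width of the strip has to be allowed to shrink when two lifts are stacked.\<close>
  have column: "\<exists>e>0. \<exists>g. lifts (?R (x - e) (x + e) 0 1) f g" for x
  proof (rule Bolzano[of 0 1 "\<lambda>c d. \<exists>e>0. \<exists>g. lifts (?R (x - e) (x + e) c d) f g"])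
    fix a b c :: real
    assume "\<exists>e>0. \<exists>g. lifts (?R (x - e) (x + e) a b) f g"
      "\<exists>e>0. \<exists>g. lifts (?R (x - e) (x + e) b c) f g" and le: "a \<le> b" "b \<le> c"
    then obtain e e' g g' where eg: "e > 0" "e' > 0" "lifts (?R (x - e) (x + e) a b) f g"
      "lifts (?R (x - e') (x + e') b c) f g'" by blast
    define m where "m = min e e'"
    have "\<exists>k. lifts (?R (x - m) (x + m) a b \<union> ?R (x - m) (x + m) b c) f k"
      by (rule glue[OF refl refl]) (rule lifts_subset[OF eg(3)], force simp: m_def,
          rule lifts_subset[OF eg(4)], force simp: m_def)
    moreover have "?R (x - m) (x + m) a b \<union> ?R (x - m) (x + m) b c = ?R (x - m) (x + m) a c"
      using le by auto
    ultimately show "\<exists>e>0. \<exists>g. lifts (?R (x - e) (x + e) a c) f g"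
      using eg(1,2) by (intro exI[of _ m]) (auto simp: m_def)
  next
    fix y :: real
    obtain d g where d: "d > 0" and g: "lifts (S \<inter> ball (x, y) d) f g"
      using lifts_local[OF f S(1)] by blast
    have "\<exists>e>0. \<exists>g. lifts (?R (x - e) (x + e) a b) f g" if "a \<le> y" "y \<le> b" "b - a < d/2" for a b
    proof -
      have "(u, v) \<in> ball (x, y) d" if "u \<in> {x - d/2..x + d/2}" "v \<in> {a..b}" for u v
      proof -
        have "dist (x, y) (u, v) \<le> \<bar>x - u\<bar> + \<bar>y - v\<bar>"
          unfolding dist_Pair_Pair dist_real_def using sqrt_sum_squares_le_sum_abs by simp
        also have "\<dots> < d"
          using that \<open>a \<le> y\<close> \<open>y \<le> b\<close> \<open>b - a < d/2\<close> by auto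
        finally show ?thesis by simp
      qed
      then have "?R (x - d/2) (x + d/2) a b \<subseteq> S \<inter> ball (x, y) d" by auto
      then have "lifts (?R (x - d/2) (x + d/2) a b) f g"
        by (rule lifts_subset[OF g])
      then show ?thesis using d half_gt_zero by blast
    qed
    then show "\<exists>d>0. \<forall>a b. a \<le> y \<and> y \<le> b \<and> b - a < d \<longrightarrow> (\<exists>e>0. \<exists>g. lifts (?R (x - e) (x + e) a b) f g)"
      using d by (intro exI[of _ "d/2"]) auto
  qed simp
  have "\<exists>g. lifts (?R 0 1 0 1) f g"
  proof (rule Bolzano[of 0 1 "\<lambda>a b. \<exists>g. lifts (?R a b 0 1) f g"])
    fix a b c :: real
    assume "\<exists>g. lifts (?R a b 0 1) f g" "\<exists>g. lifts (?R b c 0 1) f g" and le: "a \<le> b" "b \<le> c"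
    then have "\<exists>k. lifts (?R a b 0 1 \<union> ?R b c 0 1) f k"
      using glue[OF refl refl] by blast
    moreover have "?R a b 0 1 \<union> ?R b c 0 1 = ?R a c 0 1" using le by auto
    ultimately show "\<exists>g. lifts (?R a c 0 1) f g" by simp
  next
    fix x :: real
    obtain e g where e: "e > 0" and g: "lifts (?R (x - e) (x + e) 0 1) f g" using column by blast
    have "\<exists>g. lifts (?R a b 0 1) f g" if "a \<le> x" "x \<le> b" "b - a < e" for a b
      by (rule exI, rule lifts_subset[OF g]) (use that in auto)
    then show "\<exists>d>0. \<forall>a b. a \<le> x \<and> x \<le> b \<and> b - a < d \<longrightarrow> (\<exists>g. lifts (?R a b 0 1) f g)"
      using e by blast
  qed simp
  moreover have "?R 0 1 0 1 = S" using S(3) by auto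
  ultimately show ?thesis by simp
qed

text \<open>Lifts over an interval agree up to a constant, so the increment does not depend on the choice
(\<open>winding_eq\<close>).\<close>

definition winding :: "(real \<Rightarrow> real) \<Rightarrow> real" where
  "winding f = (let g = (SOME g. lifts {0..1} f g) in g 1 - g 0)"

lemma winding_eq:
  assumes "lifts {0..1} f g"
  shows "winding f = g 1 - g 0"
proof -
  have "lifts {0..1} f (SOME g. lifts {0..1} f g)"
    by (rule someI[of "lifts {0..1} f"]) fact
  from lifts_unique[OF _ this assms, of 0 1] show ?thesis
    by (simp add: winding_def Let_def)
qed

lemma winding_segment:
  fixes p q :: "'a::real_normed_vector"
  assumes G: "lifts S f G" and "convex S" "p \<in> S" "q \<in> S"
    and h: "\<And>s. 0 \<le> s \<Longrightarrow> s \<le> 1 \<Longrightarrow> h s = f ((1 - s) *\<^sub>R p + s *\<^sub>R q)"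
  shows "winding h = G q - G p"
proof -
  let ?l = "\<lambda>s. (1 - s) *\<^sub>R p + s *\<^sub>R q"
  have "lifts {0..1} (f \<circ> ?l) (G \<circ> ?l)"
    using assms(2-4) by (intro lifts_compose[OF G] continuous_intros) (auto simp: convex_alt)
  then have "lifts {0..1} h (G \<circ> ?l)"
    by (auto simp: lifts_def h)
  from winding_eq[OF this] show ?thesis by simp
qed


section \<open>Coordinates on a wedge of two circles\<close>

text \<open>The closeness that generates the closure: \<open>x\<close> lies in the closure of \<open>A\<close> iff \<open>A\<close> has points near \<open>x\<close>
for every \<open>e > 0\<close>.  Points of different circles are never near, unless one of them is the
basepoint, which belongs to both.\<close>

definition near :: "(bool \<Rightarrow> real) \<Rightarrow> (bool \<Rightarrow> real \<Rightarrow> 'p) \<Rightarrow> real \<Rightarrow> 'p \<Rightarrow> 'p \<Rightarrow> bool" where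
  "near r iota e x y \<longleftrightarrow> (\<exists>k u v. x = iota k u \<and> y = iota k v \<and> \<bar>u - v\<bar> < r k + e)"

text \<open>The properties of the wedge on which the computation rests.  The lines \<open>iota True\<close> and \<open>iota False\<close>
wrap around the two circles with period \<open>1\<close> and meet at the integers, which all map to the
basepoint.\<close>

locale wedge_coordinates =
  fixes X :: "'p cspace" and r :: "bool \<Rightarrow> real" and iota :: "bool \<Rightarrow> real \<Rightarrow> 'p"
  assumes r_pos: "0 < r k"
    and points_eq: "points X = (\<Union>k. range (iota k))"
    and iota_eq_iff: "iota k u = iota l v \<longleftrightarrow> (if k = l then u - v \<in> \<int> else u \<in> \<int> \<and> v \<in> \<int>)"
    and clos_eq: "A \<subseteq> points X \<Longrightarrow> clos X A = {x. \<forall>e>0. \<exists>y\<in>A. near r iota e x y}"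
begin

lemma iota_in_points [simp]: "iota k u \<in> points X"
  by (auto simp: points_eq)

lemma iota_shift [simp]: "iota k (u + of_int n) = iota k u"
  by (simp add: iota_eq_iff)

text \<open>Two points of a circle of circumference \<open>1\<close> have distance at most \<open>1/2\<close>, so the closure is
indiscrete.\<close>

lemma near_of_large_radius:
  assumes "1/2 \<le> r k" "0 < e"
  shows "near r iota e (iota k u) (iota k v)"
proof -
  have "\<bar>u - (v + of_int (round (u - v)))\<bar> \<le> 1/2"
    using of_int_round_abs_le[of "u - v"] by linarith
  then show ?thesis
    unfolding near_def using assms
    by (intro exI[of _ k] exI[of _ u] exI[of _ "v + of_int (round (u - v))"]) auto
qed

text \<open>On a metric domain, continuity between closure spaces is a statement about neighbourhoods: if \<open>F\<close>
had far values arbitrarily close to \<open>t\<close>, then \<open>t\<close> would lie in the closure of the set of those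
arguments, while \<open>F t\<close> would not lie in the closure of its image.\<close>

lemma continuous_into_iff:
  fixes D :: "'a::metric_space set"
  shows "continuous_into D X F \<longleftrightarrow>
     F ` D \<subseteq> points X \<and>
     (\<forall>t\<in>D. \<forall>e>0. \<exists>d>0. \<forall>s\<in>D. dist t s < d \<longrightarrow> near r iota e (F t) (F s))"
    (is "?L \<longleftrightarrow> ?R")
proof -
  have clos: "clos (cspace_of_topology (top_of_set D)) A = D \<inter> closure A" if "A \<subseteq> D" for A
    using that by (simp add: cspace_of_topology_def closure_of_subtopology inf_absorb2)
  have pts: "points (cspace_of_topology (top_of_set D)) = D"
    by (simp add: cspace_of_topology_def)
  show ?thesis
  proof
    assume L: ?L
    then have sub: "F ` D \<subseteq> points X" by (simp add: cs_continuous_def pts)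
    have "\<exists>d>0. \<forall>s\<in>D. dist t s < d \<longrightarrow> near r iota e (F t) (F s)" if t: "t \<in> D" and e: "e > 0" for t e
    proof (rule ccontr)
      assume N: "\<nexists>d. d > 0 \<and> (\<forall>s\<in>D. dist t s < d \<longrightarrow> near r iota e (F t) (F s))"
      define A where "A = {s \<in> D. \<not> near r iota e (F t) (F s)}"
      have A: "A \<subseteq> D" by (auto simp: A_def)
      have "t \<in> closure A"
        unfolding closure_approachable using N by (auto simp: A_def dist_commute)
      moreover have "F ` (D \<inter> closure A) \<subseteq> clos X (F ` A)"
        using L A clos by (auto simp: cs_continuous_def pts)
      ultimately have "F t \<in> clos X (F ` A)" using t by blast
      then obtain y where "y \<in> F ` A" "near r iota e (F t) y"
        using clos_eq[of "F ` A"] sub A e by auto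
      then show False by (auto simp: A_def)
    qed
    then show ?R using sub by blast
  next
    assume R: ?R
    have "F t \<in> clos X (F ` A)" if A: "A \<subseteq> D" and t: "t \<in> D" "t \<in> closure A" for A t
    proof -
      have "\<exists>y\<in>F ` A. near r iota e (F t) y" if e: "e > 0" for e
      proof -
        obtain d where "d > 0" "\<And>s. s \<in> D \<Longrightarrow> dist t s < d \<Longrightarrow> near r iota e (F t) (F s)"
          using R t e by meson
        moreover then obtain s where "s \<in> A" "dist s t < d"
          using t(2) unfolding closure_approachable by blast
        ultimately show ?thesis using A by (auto simp: dist_commute)
      qed
      moreover have "F ` A \<subseteq> points X" using A R by auto
      ultimately show ?thesis by (simp add: clos_eq)
    qed
    then show ?L using R by (auto simp: cs_continuous_def pts clos)
  qed
qed

lemma continuous_into_iota: "continuous_into UNIV X (iota k)"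
proof -
  have "near r iota e (iota k t) (iota k s)" if "dist t s < r k" "e > 0" for e t s
    unfolding near_def using that
    by (intro exI[of _ k] exI[of _ t] exI[of _ s]) (auto simp: dist_real_def)
  then show ?thesis
    using r_pos[of k] unfolding continuous_into_iff by auto
qed


section \<open>The two loops generate the first homology\<close>

definition arc :: "bool \<Rightarrow> real \<Rightarrow> real \<Rightarrow> 'p chain" where
  "arc k u v = frag_of (seg (iota k) u v)"

definition loop :: "bool \<Rightarrow> 'p chain" where
  "loop k = arc k 0 1"

text \<open>The 1-chains that are homologous to an integer combination of the two loops.  All the computations
with paths are made modulo this subgroup, in which integer translations of the parameter are
invisible.\<close>

definition loop_span :: "'p chain set" where
  "loop_span =
     {c. \<exists>m n. c - frag_cmul m (loop True) - frag_cmul n (loop False) \<in> cs_boundaries 1 X}"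

lemma loop_spanI:
  "c - frag_cmul m (loop True) - frag_cmul n (loop False) \<in> cs_boundaries 1 X \<Longrightarrow> c \<in> loop_span"
  by (auto simp: loop_span_def)

lemma boundaries_loop_span: "c \<in> cs_boundaries 1 X \<Longrightarrow> c \<in> loop_span"
  by (rule loop_spanI[of c 0 0]) simp

lemma loop_span_diff:
  assumes "b \<in> loop_span" "c \<in> loop_span"
  shows "b - c \<in> loop_span"
proof -
  obtain m n m' n' where
    "b - frag_cmul m (loop True) - frag_cmul n (loop False) \<in> cs_boundaries 1 X"
    "c - frag_cmul m' (loop True) - frag_cmul n' (loop False) \<in> cs_boundaries 1 X"
    using assms by (auto simp: loop_span_def)
  from cs_boundaries_diff[OF this] show ?thesis
    by (intro loop_spanI[of _ "m - m'" "n - n'"])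
       (simp add: frag_cmul_diff_distrib algebra_simps)
qed

lemma loop_span_0: "0 \<in> loop_span"
  by (intro boundaries_loop_span cs_boundaries_0)

lemma loop_span_add: "b \<in> loop_span \<Longrightarrow> c \<in> loop_span \<Longrightarrow> b + c \<in> loop_span"
  using diff_closed_imp_add_closed[of loop_span] loop_span_0 loop_span_diff by blast

lemma loop_in_loop_span: "loop k \<in> loop_span"
  by (cases k) (auto intro: loop_spanI[of _ 1 0] loop_spanI[of _ 0 1] simp: cs_boundaries_0)

lemma arc_triangle: "arc k v w - arc k u w + arc k u v \<in> loop_span"
  unfolding arc_def
  by (intro boundaries_loop_span seg_triangle_boundary[OF continuous_into_iota]) auto

lemma arc_refl: "arc k u u \<in> loop_span"
  using arc_triangle[of k u u u] by simp

lemma arc_shift: "arc k (u + of_int n) (v + of_int n) = arc k u v"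
proof -
  have "iota k (t 0 *\<^sub>R (u + of_int n) + t 1 *\<^sub>R (v + of_int n)) = iota k (t 0 *\<^sub>R u + t 1 *\<^sub>R v)"
    if "t \<in> standard_simplex 1" for t
  proof -
    have "t 0 + t 1 = 1" using that unfolding standard_simplex_1_iff by simp
    then have "t 0 *\<^sub>R (u + of_int n) + t 1 *\<^sub>R (v + of_int n) = t 0 *\<^sub>R u + t 1 *\<^sub>R v + of_int n"
      by (simp add: algebra_simps) (metis distrib_left mult.right_neutral)
    then show ?thesis by (simp only: iota_shift)
  qed
  then show ?thesis by (simp add: arc_def seg_def cong: restrict_cong)
qed

lemma arc_int: "arc k 0 (of_int n) \<in> loop_span"
proof -
  have nat: "arc k 0 (of_nat n) \<in> loop_span" for n
  proof (induction n)
    case 0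
    then show ?case by (simp add: arc_refl)
  next
    case (Suc n)
    have "arc k (of_nat n) (of_nat (Suc n)) = loop k"
      using arc_shift[of k 0 "int n" 1] by (simp add: loop_def algebra_simps)
    then have "arc k 0 (of_nat n) + loop k - arc k 0 (of_nat (Suc n)) \<in> loop_span"
      using arc_triangle[of k "of_nat n" "of_nat (Suc n)" 0] by (simp add: algebra_simps)
    then show ?case
      using loop_span_diff[OF loop_span_add[OF Suc loop_in_loop_span[of k]]] by fastforce
  qed
  show ?thesis
  proof (cases "n \<ge> 0")
    case True
    then show ?thesis using nat[of "nat n"] by simp
  next
    case False
    define m where "m = nat (- n)"
    have n: "real_of_int n = - of_nat m" using False by (simp add: m_def)
    have "arc k 0 (- of_nat m) = arc k (of_nat m) 0"
      using arc_shift[of k "of_nat m" "- int m" 0] by simp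
    moreover have "arc k (of_nat m) 0 - arc k 0 0 + arc k 0 (of_nat m) \<in> loop_span"
      by (rule arc_triangle)
    ultimately show ?thesis
      using loop_span_add[OF loop_span_diff[OF _ nat[of m]] arc_refl[of k 0]] n by fastforce
  qed
qed

text \<open>Modulo the loops, the arc from the basepoint to a point depends only on the point: two coordinates
differ by an integer, or both are integers and the point is the basepoint.\<close>

lemma arc_endpoint:
  assumes "iota k u = iota l v"
  shows "arc k 0 u - arc l 0 v \<in> loop_span"
proof (cases "k = l")
  case True
  then have "u - v \<in> \<int>" using assms by (simp add: iota_eq_iff)
  then obtain n where n: "u = of_int n + v" by (metis Ints_cases diff_add_cancel)
  have "arc k (of_int n) u - arc k 0 u + arc k 0 (of_int n) \<in> loop_span"
    by (rule arc_triangle)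
  moreover have "arc k (of_int n) u = arc k 0 v"
    using arc_shift[of k 0 n v] n by (simp add: add.commute)
  ultimately show ?thesis
    using loop_span_diff[OF arc_int[of k n]] True by fastforce
next
  case False
  then obtain m n where "u = of_int m" "v = of_int n"
    using assms by (auto simp: iota_eq_iff elim!: Ints_cases)
  then show ?thesis by (simp add: arc_int loop_span_diff)
qed

text \<open>By \<open>arc_endpoint\<close>, the arbitrary choice of a coordinate changes the chain only within \<open>loop_span\<close>.\<close>

definition base_path :: "'p \<Rightarrow> 'p chain" where
  "base_path x = (case (SOME (k, u). iota k u = x) of (k, u) \<Rightarrow> arc k 0 u)"

lemma base_path_iota: "base_path (iota k u) - arc k 0 u \<in> loop_span"
proof -
  obtain l v where lv: "(SOME (l, v). iota l v = iota k u) = (l, v)" by (meson surj_pair)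
  moreover have "case (SOME (l, v). iota l v = iota k u) of (l, v) \<Rightarrow> iota l v = iota k u"
    by (rule someI[of "\<lambda>(l, v). iota l v = iota k u" "(k, u)"]) simp
  ultimately have "iota l v = iota k u" by simp
  then show ?thesis using arc_endpoint lv by (simp add: base_path_def)
qed

lemma arc_base_path: "arc k u v - (base_path (iota k v) - base_path (iota k u)) \<in> loop_span"
proof -
  have "(arc k u v - arc k 0 v + arc k 0 u) - (base_path (iota k v) - arc k 0 v)
      + (base_path (iota k u) - arc k 0 u) \<in> loop_span"
    by (intro loop_span_add loop_span_diff arc_triangle base_path_iota)
  then show ?thesis by (simp add: algebra_simps)
qed


text \<open>Coordinates of a point near the centre \<open>x\<close> relative to one fixed coordinate \<open>u k\<close> of \<open>x\<close> on each
circle through \<open>x\<close>.  On an indiscrete circle the bound \<open>\<bar>h\<bar> \<le> 1/2\<close> is obtained by reduction modulo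
the integers; it is needed so that the basepoint, when seen from itself, has coordinate \<open>h = 0\<close>.\<close>

lemma star_chart:
  assumes x: "near r iota e x y"
    and radius: "\<And>k. r k < 1/3 \<and> r k + e \<le> 1/3 \<or> 1/2 \<le> r k"
    and u: "\<And>k v. iota k v = x \<Longrightarrow> iota k (u k) = x"
  obtains k h where "iota k (u k) = x" "y = iota k (u k + h)" "\<bar>h\<bar> \<le> 1/2" "r k < 1/3 \<Longrightarrow> \<bar>h\<bar> < 1/3"
proof -
  obtain k a b where ab: "x = iota k a" "y = iota k b" "\<bar>a - b\<bar> < r k + e"
    using x by (auto simp: near_def)
  have xk: "iota k (u k) = x" using u ab(1) by metis
  then have Z: "u k - a \<in> \<int>" using ab(1) by (simp add: iota_eq_iff)
  consider "r k < 1/3" "r k + e \<le> 1/3" | "1/2 \<le> r k" using radius[of k] by auto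
  then show ?thesis
  proof cases
    case 1
    have "iota k (u k + (b - a)) = y"
      using Z by (simp add: ab(2) iota_eq_iff)
    moreover have "\<bar>b - a\<bar> < 1/3" using ab(3) 1 by linarith
    ultimately show ?thesis
      using that[of k "b - a"] xk by simp
  next
    case 2
    let ?h = "(b - a) - of_int (round (b - a))"
    have "b - (u k + ?h) = - (u k - a) + of_int (round (b - a))" by simp
    also have "\<dots> \<in> \<int>" using Z by (intro Ints_add Ints_minus) auto
    finally have "b - (u k + ?h) \<in> \<int>" .
    moreover have "\<bar>?h\<bar> \<le> 1/2" using of_int_round_abs_le[of "b - a"] by linarith
    ultimately show ?thesis
      using that[of k ?h] xk ab 2 by (auto simp: iota_eq_iff)
  qed
qed

text \<open>Two points of a star that are near each other are near in the coordinates of the star as well, and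
these can be taken on the same circle.  On a circle of small radius the coordinates \<open>h\<close>, \<open>h'\<close> and
the jump between the points form a triangle of sides below \<open>1/3\<close>, which cannot wind.  If the points
have coordinates on different circles, the centre is the basepoint and one of the two points is the
basepoint too; it has coordinate \<open>0\<close> on both circles.\<close>

lemma star_pair:
  assumes near: "near r iota e (iota k (u k + h)) (iota k' (u k' + h'))"
    and x: "iota k (u k) = x" "iota k' (u k') = x"
    and h: "\<bar>h\<bar> \<le> 1/2" "r k < 1/3 \<Longrightarrow> \<bar>h\<bar> < 1/3"
    and h': "\<bar>h'\<bar> \<le> 1/2" "r k' < 1/3 \<Longrightarrow> \<bar>h'\<bar> < 1/3"
    and radius: "\<And>k. r k < 1/3 \<and> r k + e \<le> 1/3 \<or> 1/2 \<le> r k" and e: "e > 0"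
  shows "\<exists>l p p'. (\<forall>v. iota k (u k + v * h) = iota l (u l + v * p)) \<and>
                  (\<forall>v. iota k' (u k' + v * h') = iota l (u l + v * p')) \<and>
                  \<bar>p'\<bar> \<le> 1/2 \<and> (1/2 \<le> r l \<or> \<bar>p - p'\<bar> < r l + e)"
proof -
  obtain l w w' where w: "iota k (u k + h) = iota l w" "iota k' (u k' + h') = iota l w'" "\<bar>w - w'\<bar> < r l + e"
    using near by (auto simp: near_def)
  have zero: "h = 0" if "h \<in> \<int>" "\<bar>h\<bar> \<le> 1/2" for h :: real
    using that by (intro Ints_eq_0) auto
  show ?thesis
  proof (cases "k = k'")
    case True
    have "1/2 \<le> r k \<or> \<bar>h - h'\<bar> < r k + e"
    proof (cases "1/2 \<le> r k")
      case False
      then have small: "r k < 1/3" "r k + e \<le> 1/3" using radius[of k] by auto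
      have "\<bar>h\<bar> < 1/3" "\<bar>h'\<bar> < 1/3" using small(1) h(2) h'(2) True by blast+
      then have hh: "\<bar>h - h'\<bar> < 2/3" by linarith
      show ?thesis
      proof (cases "l = k")
        case True
        then have "u k + h - w \<in> \<int>" "u k + h' - w' \<in> \<int>"
          using w \<open>k = k'\<close> by (auto simp: iota_eq_iff)
        then have "(u k + h - w) - (u k + h' - w') \<in> \<int>" by (rule Ints_diff)
        moreover have "\<bar>(u k + h - w) - (u k + h' - w')\<bar> < 1"
          using hh w(3)[unfolded True] small by linarith
        ultimately have "(u k + h - w) - (u k + h' - w') = 0" by (rule Ints_eq_0)
        then have "h - h' = w - w'" by simp
        then show ?thesis using w(3) True by simp
      next
        case False
        then have "u k + h \<in> \<int>" "u k + h' \<in> \<int>"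
          using w \<open>k = k'\<close> by (auto simp: iota_eq_iff)
        then have "(u k + h) - (u k + h') \<in> \<int>" by (rule Ints_diff)
        then have "(u k + h) - (u k + h') = 0"
          using hh by (intro Ints_eq_0) auto
        then show ?thesis using e r_pos[of k] by auto
      qed
    qed auto
    then show ?thesis using h'(1) True by (intro exI[of _ k] exI[of _ h] exI[of _ h']) auto
  next
    case False
    then have u: "u k \<in> \<int>" "u k' \<in> \<int>" using x by (metis iota_eq_iff)+
    consider "l = k" "l \<noteq> k'" | "l = k'" "l \<noteq> k" using False by auto
    then show ?thesis
    proof cases
      case 1
      then have "u k' + h' \<in> \<int>" "w' \<in> \<int>" "u k + h - w \<in> \<int>" using w by (auto simp: iota_eq_iff)
      then have "h' = 0" using zero[OF _ h'(1)] u Ints_diff[of "u k' + h'" "u k'"] by simp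
      moreover have "1/2 \<le> r k \<or> \<bar>h - 0\<bar> < r k + e"
      proof (cases "1/2 \<le> r k")
        case False
        then have small: "r k < 1/3" "r k + e \<le> 1/3" using radius[of k] by auto
        have "(u k + h - w) - u k + w' \<in> \<int>"
          by (rule Ints_add[OF Ints_diff[OF \<open>u k + h - w \<in> \<int>\<close> u(1)] \<open>w' \<in> \<int>\<close>])
        moreover have "\<bar>(u k + h - w) - u k + w'\<bar> < 1" using h(2) small w(3) 1 by auto
        ultimately have "(u k + h - w) - u k + w' = 0" by (rule Ints_eq_0)
        then show ?thesis using w(3) 1 by auto
      qed auto
      ultimately show ?thesis using x by (intro exI[of _ k] exI[of _ h] exI[of _ 0]) auto
    next
      case 2
      then have "u k + h \<in> \<int>" "w \<in> \<int>" "u k' + h' - w' \<in> \<int>" using w by (auto simp: iota_eq_iff)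
      then have "h = 0" using zero[OF _ h(1)] u Ints_diff[of "u k + h" "u k"] by simp
      moreover have "1/2 \<le> r k' \<or> \<bar>0 - h'\<bar> < r k' + e"
      proof (cases "1/2 \<le> r k'")
        case False
        then have small: "r k' < 1/3" "r k' + e \<le> 1/3" using radius[of k'] by auto
        have "(u k' + h' - w') - u k' + w \<in> \<int>"
          by (rule Ints_add[OF Ints_diff[OF \<open>u k' + h' - w' \<in> \<int>\<close> u(2)] \<open>w \<in> \<int>\<close>])
        moreover have "\<bar>(u k' + h' - w') - u k' + w\<bar> < 1" using h'(2) small w(3) 2 by auto
        ultimately have "(u k' + h' - w') - u k' + w = 0" by (rule Ints_eq_0)
        then show ?thesis using w(3) 2 by auto
      qed auto
      ultimately show ?thesis using x h'(1) by (intro exI[of _ k'] exI[of _ 0] exI[of _ h']) auto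
    qed
  qed
qed

text \<open>Scaling by \<open>v \<in> [0, 1]\<close> does not enlarge the distance between two coordinates on the same line, and
a change of \<open>v\<close> moves points by an arbitrarily small amount.\<close>

lemma star_contraction_continuous:
  fixes D :: "real set"
  assumes F: "continuous_into D X F"
    and K: "\<And>s. s \<in> D \<Longrightarrow> iota (K s) (u (K s)) = x \<and> F s = iota (K s) (u (K s) + h s) \<and>
              \<bar>h s\<bar> \<le> 1/2 \<and> (r (K s) < 1/3 \<longrightarrow> \<bar>h s\<bar> < 1/3)"
    and radius: "\<And>k. r k < 1/3 \<and> r k + e \<le> 1/3 \<or> 1/2 \<le> r k" and e: "e > 0"
  shows "continuous_into (D \<times> {0..1}) X (\<lambda>(s, v). iota (K s) (u (K s) + v * h s))"
    (is "continuous_into _ X ?H")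
  unfolding continuous_into_iff
proof (intro conjI ballI allI impI)
  show "?H ` (D \<times> {0..1}) \<subseteq> points X" by auto
  fix z :: "real \<times> real" and d :: real
  assume "z \<in> D \<times> {0..1}" and d: "d > 0"
  then obtain s v where z: "z = (s, v)" "s \<in> D" "0 \<le> v" "v \<le> 1" by auto
  \<comment> \<open>Half of the tolerance is for the jump of \<open>F\<close>, the other half for the change of \<open>v\<close>.\<close>
  define c where "c = min e (d/2)"
  have c: "c > 0" "c \<le> e" "c \<le> d/2" using e d by (auto simp: c_def)
  have radius_c: "r k < 1/3 \<and> r k + c \<le> 1/3 \<or> 1/2 \<le> r k" for k
    using radius[of k] c by auto
  obtain g where g: "g > 0" "\<And>s'. s' \<in> D \<Longrightarrow> dist s s' < g \<Longrightarrow> near r iota c (F s) (F s')"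
    using F z(2) c(1) unfolding continuous_into_iff by meson
  have "near r iota d (?H z) (?H (s', v'))"
    if s': "s' \<in> D" "0 \<le> v'" "v' \<le> 1" "dist z (s', v') < min g d" for s' v'
  proof -
    have "dist s s' < g" "\<bar>v - v'\<bar> < d"
      using s'(4) dist_fst_le[of z "(s', v')"] dist_snd_le[of z "(s', v')"]
      by (auto simp: z dist_real_def)
    then have "near r iota c (iota (K s) (u (K s) + h s)) (iota (K s') (u (K s') + h s'))"
      using g(2)[of s'] K[of s] K[of s'] z(2) s'(1) by auto
    then obtain l p p' where p:
      "\<And>v. iota (K s) (u (K s) + v * h s) = iota l (u l + v * p)"
      "\<And>v. iota (K s') (u (K s') + v * h s') = iota l (u l + v * p')"
      "\<bar>p'\<bar> \<le> 1/2" "1/2 \<le> r l \<or> \<bar>p - p'\<bar> < r l + c"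
      using star_pair[of c "K s" u "h s" "K s'" "h s'" x] K[of s] K[of s'] z(2) s'(1) radius_c c(1)
      by metis
    have "near r iota d (iota l (u l + v * p)) (iota l (u l + v' * p'))"
    proof (cases "1/2 \<le> r l")
      case True
      then show ?thesis using d by (rule near_of_large_radius)
    next
      case False
      have "v * p - v' * p' = v * (p - p') + (v - v') * p'" by (simp add: algebra_simps)
      then have "\<bar>v * p - v' * p'\<bar> \<le> v * \<bar>p - p'\<bar> + \<bar>v - v'\<bar> * \<bar>p'\<bar>"
        using z abs_triangle_ineq[of "v * (p - p')" "(v - v') * p'"] by (simp add: abs_mult)
      also have "\<dots> \<le> 1 * \<bar>p - p'\<bar> + d * (1/2)"
        using z p(3) \<open>\<bar>v - v'\<bar> < d\<close> by (intro add_mono mult_mono) auto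
      also have "\<dots> < r l + d" using False p(4) c by auto
      finally show ?thesis
        unfolding near_def
        by (intro exI[of _ l] exI[of _ "u l + v * p"] exI[of _ "u l + v' * p'"]) auto
    qed
    then show ?thesis by (simp add: z p)
  qed
  then show "\<exists>d'>0. \<forall>y\<in>D \<times> {0..1}. dist z y < d' \<longrightarrow> near r iota d (?H z) (?H y)"
    using g(1) d by (intro exI[of _ "min g d"]) fastforce
qed

text \<open>The contraction \<open>H\<close> on the strip \<open>[a, b] \<times> [0, 1]\<close> has the path as its top edge, a constant path as
its bottom edge, and arcs issuing from the centre as its vertical edges.\<close>

lemma star_piece:
  fixes a b :: real
  assumes F: "continuous_into {a..b} X F" and ab: "a \<le> b"
    and near: "\<And>s. s \<in> {a..b} \<Longrightarrow> near r iota e x (F s)"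
    and radius: "\<And>k. r k < 1/3 \<and> r k + e \<le> 1/3 \<or> 1/2 \<le> r k" and e: "e > 0"
  shows "frag_of (seg F a b) - (base_path (F b) - base_path (F a)) \<in> loop_span"
proof -
  define u where "u k = (SOME v. iota k v = x)" for k
  have u: "iota k (u k) = x" if "iota k v = x" for k v
    unfolding u_def by (rule someI[of "\<lambda>v. iota k v = x"]) fact
  have "\<exists>k h. iota k (u k) = x \<and> F s = iota k (u k + h) \<and> \<bar>h\<bar> \<le> 1/2 \<and> (r k < 1/3 \<longrightarrow> \<bar>h\<bar> < 1/3)"
    if "s \<in> {a..b}" for s
    by (rule star_chart[OF near[OF that] radius, of u]) (use u in blast)+
  then obtain K h where K: "\<And>s. s \<in> {a..b} \<Longrightarrow> iota (K s) (u (K s)) = x \<and>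
      F s = iota (K s) (u (K s) + h s) \<and> \<bar>h s\<bar> \<le> 1/2 \<and> (r (K s) < 1/3 \<longrightarrow> \<bar>h s\<bar> < 1/3)"
    by metis
  define H where "H = (\<lambda>(s, v). iota (K s) (u (K s) + v * h s))"
  have H: "continuous_into ({a..b} \<times> {0..1}) X H"
    unfolding H_def using K by (intro star_contraction_continuous[OF F _ radius e, where x = x]) blast
  have conv: "convex ({a..b} \<times> {0..1::real})" by (intro convex_Times) auto
  let ?s = "\<lambda>p q. frag_of (seg H p q)"
  \<comment> \<open>The strip is cut along the diagonal from \<open>(a, 0)\<close> to \<open>(b, 1)\<close>; the third triangle is degenerate and makes the bottom edge a boundary.\<close>
  have square: "?s (a,1) (b,1) - ?s (a,0) (b,1) + ?s (a,0) (a,1) \<in> loop_span"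
    "?s (b,0) (b,1) - ?s (a,0) (b,1) + ?s (a,0) (b,0) \<in> loop_span"
    "?s (a,0) (a,0) - ?s (a,0) (a,0) + ?s (a,0) (a,0) \<in> loop_span"
    using ab by (intro boundaries_loop_span seg_triangle_boundary[OF H conv]; simp)+
  have conv_ab: "t 0 *\<^sub>R a + t 1 *\<^sub>R b \<in> {a..b}" "t 0 + t 1 = 1" if "t \<in> standard_simplex 1" for t :: "nat \<Rightarrow> real"
    using that convexD[of "{a..b}" a b "t 0" "t 1"] ab unfolding standard_simplex_1_iff by auto
  have top: "seg H (a,1) (b,1) = seg F a b"
    unfolding seg_def using K conv_ab by (intro restrict_ext) (simp add: H_def)
  have bottom: "seg H (a,0) (b,0) = seg H (a,0) (a,0)"
    unfolding seg_def
  proof (rule restrict_ext)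
    fix t :: "nat \<Rightarrow> real" assume t: "t \<in> standard_simplex 1"
    have "t 0 * a + t 1 * a = a" using conv_ab(2)[OF t] by (metis distrib_right mult_1)
    then show "H (t 0 *\<^sub>R (a, 0) + t 1 *\<^sub>R (b, 0)) = H (t 0 *\<^sub>R (a, 0) + t 1 *\<^sub>R (a, 0))"
      using K conv_ab(1)[OF t] ab by (simp add: H_def)
  qed
  have side: "?s (s,0) (s,1) = arc (K s) (u (K s)) (u (K s) + h s)" if "s \<in> {a..b}" for s
    unfolding seg_def arc_def
  proof (rule arg_cong[of _ _ frag_of], rule restrict_ext)
    fix t :: "nat \<Rightarrow> real" assume t: "t \<in> standard_simplex 1"
    have *: "t 0 * y + t 1 * y = y" for y using conv_ab(2)[OF t] by (metis distrib_right mult_1)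
    have "t 0 * u (K s) + t 1 * (u (K s) + h s) = u (K s) + t 1 * h s"
      using *[of "u (K s)"] by (simp add: distrib_left)
    then show "H (t 0 *\<^sub>R (s, 0) + t 1 *\<^sub>R (s, 1)) = iota (K s) (t 0 *\<^sub>R u (K s) + t 1 *\<^sub>R (u (K s) + h s))"
      using * by (simp add: H_def)
  qed
  have side': "?s (s,0) (s,1) - (base_path (F s) - base_path x) \<in> loop_span" if "s \<in> {a..b}" for s
    using arc_base_path[of "K s" "u (K s)" "u (K s) + h s"] K[OF that] by (simp add: side[OF that])
  have "(?s (a,1) (b,1) - ?s (a,0) (b,1) + ?s (a,0) (a,1))
      - (?s (b,0) (b,1) - ?s (a,0) (b,1) + ?s (a,0) (b,0))
      + (?s (a,0) (a,0) - ?s (a,0) (a,0) + ?s (a,0) (a,0))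
      - (?s (a,0) (a,1) - (base_path (F a) - base_path x))
      + (?s (b,0) (b,1) - (base_path (F b) - base_path x)) \<in> loop_span"
    using side'[of a] side'[of b] ab
    by (intro loop_span_add[OF loop_span_diff[OF loop_span_add[OF loop_span_diff[OF square(1,2)] square(3)]]]) auto
  then show ?thesis by (simp add: top bottom algebra_simps)
qed

text \<open>Bisection reduces the claim to intervals whose images lie in the star of one of their points.\<close>

lemma simplex_base_path:
  assumes \<sigma>: "cs_simplex 1 X \<sigma>" and gap: "\<And>k. r k < 1/3 \<or> 1/2 \<le> r k"
  shows "frag_of \<sigma> - (base_path (\<sigma> (edge 1)) - base_path (\<sigma> (edge 0))) \<in> loop_span"
proof -
  define F where "F = \<sigma> \<circ> edge"
  have F: "continuous_into {0..1} X F"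
    unfolding F_def by (rule continuous_into_edge[OF \<sigma>])
  obtain e where e: "e > 0" and radius: "\<And>k. r k < 1/3 \<and> r k + e \<le> 1/3 \<or> 1/2 \<le> r k"
  proof -
    define d where "d k = (if r k < 1/3 then 1/3 - r k else 1)" for k
    define e where "e = min (d True) (d False)"
    have "e \<le> d k" for k by (cases k) (auto simp: e_def)
    then have "r k < 1/3 \<and> r k + e \<le> 1/3 \<or> 1/2 \<le> r k" for k
      using gap[of k] by (smt (verit, best) d_def)
    moreover have "e > 0" by (auto simp: e_def d_def)
    ultimately show ?thesis using that by blast
  qed
  have sub: "continuous_into S X F" if "S \<subseteq> {0..1}" for S
    using continuous_into_compose[OF F, of S id] that by simp
  define P where "P a b \<longleftrightarrow> (0 \<le> a \<longrightarrow> b \<le> 1 \<longrightarrow>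
      frag_of (seg F a b) - (base_path (F b) - base_path (F a)) \<in> loop_span)" for a b
  have "P 0 1"
  proof (rule Bolzano[of 0 1 P])
    fix a b c assume P: "P a b" "P b c" and le: "a \<le> b" "b \<le> c"
    show "P a c"
      unfolding P_def
    proof (intro impI)
      assume "0 \<le> a" "c \<le> 1"
      then have "frag_of (seg F b c) - frag_of (seg F a c) + frag_of (seg F a b) \<in> loop_span"
        using le by (intro boundaries_loop_span seg_triangle_boundary[OF sub[of "{a..c}"]]) auto
      moreover have "frag_of (seg F a b) - (base_path (F b) - base_path (F a)) \<in> loop_span"
        "frag_of (seg F b c) - (base_path (F c) - base_path (F b)) \<in> loop_span"
        using P le \<open>0 \<le> a\<close> \<open>c \<le> 1\<close> by (auto simp: P_def)
      ultimately have "(frag_of (seg F a b) - (base_path (F b) - base_path (F a)))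
        + (frag_of (seg F b c) - (base_path (F c) - base_path (F b)))
        - (frag_of (seg F b c) - frag_of (seg F a c) + frag_of (seg F a b)) \<in> loop_span"
        by - (rule loop_span_diff[OF loop_span_add]; assumption)
      then show "frag_of (seg F a c) - (base_path (F c) - base_path (F a)) \<in> loop_span"
        by (simp add: algebra_simps)
    qed
  next
    fix x :: real assume x: "0 \<le> x" "x \<le> 1"
    then obtain d where d: "d > 0" "\<And>s. s \<in> {0..1} \<Longrightarrow> dist x s < d \<Longrightarrow> near r iota e (F x) (F s)"
      using F e unfolding continuous_into_iff by (meson atLeastAtMost_iff)
    have "P a b" if "a \<le> x" "x \<le> b" "b - a < d" for a b
      unfolding P_def
    proof (intro impI)
      assume "0 \<le> a" "b \<le> 1"
      then show "frag_of (seg F a b) - (base_path (F b) - base_path (F a)) \<in> loop_span"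
        using that by (intro star_piece[OF sub _ _ radius e, of _ _ "F x"] d(2)) (auto simp: dist_real_def)
    qed
    then show "\<exists>d>0. \<forall>a b. a \<le> x \<and> x \<le> b \<and> b - a < d \<longrightarrow> P a b" using d(1) by blast
  qed simp
  then show ?thesis
    using simplex_1_eq_seg[OF \<sigma>] by (simp add: P_def F_def)
qed

text \<open>Replacing each simplex by the difference of the base paths of its endpoints is a map that factors
through the boundary, so it annihilates cycles.\<close>

lemma cycle_in_loop_span:
  assumes c: "c \<in> cs_cycles 1 X" and gap: "\<And>k. r k < 1/3 \<or> 1/2 \<le> r k"
  shows "c \<in> loop_span"
proof -
  define Q where "Q v = base_path (v (\<lambda>j. if j = 0 then 1 else 0))" for v :: "(nat \<Rightarrow> real) \<Rightarrow> 'p"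
  have "c - frag_extend Q (chain_boundary 1 c) \<in> loop_span"
    if "c \<in> carrier (cs_chain_group 1 X)" for c
    using that
  proof (induction rule: cs_chain_induct)
    case zero
    then show ?case by (simp add: loop_span_0)
  next
    case (one \<sigma>)
    have "chain_boundary 1 (frag_of \<sigma>) = frag_of (restrict (\<lambda>_. \<sigma> (edge 1)) (standard_simplex 0))
       - frag_of (restrict (\<lambda>_. \<sigma> (edge 0)) (standard_simplex 0))"
      using chain_boundary_seg[of "\<sigma> \<circ> edge" 0 1] simplex_1_eq_seg[OF one] by simp
    then show ?case
      using simplex_base_path[OF one gap] by (simp add: frag_extend_diff Q_def standard_simplex_0)
  next
    case (diff a b)
    then have "(a - frag_extend Q (chain_boundary 1 a)) - (b - frag_extend Q (chain_boundary 1 b)) \<in> loop_span"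
      by (rule loop_span_diff)
    then show ?case by (simp add: chain_boundary_diff frag_extend_diff algebra_simps)
  qed
  from this[of c] show ?thesis using c by (simp add: cs_cycles_def)
qed

text \<open>The map that wraps the axis \<open>v = 0\<close> around the circle and sends the rest of the plane to the basepoint
is continuous because the circle is indiscrete.  In the triangle below, the loop is one side and the
other two sides are the same constant path.\<close>

lemma loop_boundary_of_large_radius:
  assumes "1/2 \<le> r k"
  shows "loop k \<in> cs_boundaries 1 X"
proof -
  define F where "F = (\<lambda>(s::real, v::real). if v = 0 then iota k s else iota k 0)"
  have "near r iota e (F z) (F w)" if "e > 0" for e z w
    using near_of_large_radius[OF assms that] by (auto simp: F_def split: prod.splits)
  then have F: "continuous_into UNIV X F"
    unfolding continuous_into_iff by (auto simp: F_def intro: zero_less_one split: if_splits)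
  have "seg F (1,0) (0,1) = seg F (0,0) (0,1)"
    unfolding seg_def
  proof (rule restrict_ext)
    fix t :: "nat \<Rightarrow> real" assume "t \<in> standard_simplex 1"
    then have "t 0 = 1" if "t 1 = 0" using that unfolding standard_simplex_1_iff by auto
    moreover have "iota k 1 = iota k 0" by (simp add: iota_eq_iff)
    ultimately show "F (t 0 *\<^sub>R (1, 0) + t 1 *\<^sub>R (0, 1)) = F (t 0 *\<^sub>R (0, 0) + t 1 *\<^sub>R (0, 1))"
      by (simp add: F_def)
  qed
  moreover have "frag_of (seg F (0,0) (1,0)) = loop k"
    by (simp add: F_def seg_def loop_def arc_def)
  ultimately show ?thesis
    using seg_triangle_boundary[OF F, of "(0,0)" "(1,0)" "(0,1)"] by simp
qed

end


section \<open>Winding numbers\<close>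

text \<open>Barycentric coordinates on a triangle in the plane.  This turns a singular 2-simplex into a map on a
plane set, where bisection is available.\<close>

definition corner :: "real \<times> real \<Rightarrow> nat \<Rightarrow> real" where
  "corner = (\<lambda>(x, y) i. if i = 0 then 1 - x else if i = 1 then x - y else if i = 2 then y else 0)"

definition triangle :: "(real \<times> real) set" where
  "triangle = {(x, y). 0 \<le> y \<and> y \<le> x \<and> x \<le> 1}"

lemma triangle_geometry:
  "convex triangle" "closed triangle" "triangle \<subseteq> {0..1} \<times> {0..1}"
  "(0,0) \<in> triangle" "(1,0) \<in> triangle" "(1,1) \<in> triangle"
proof -
  have eq: "triangle = {z. inner (0,-1) z \<le> 0} \<inter> {z. inner (-1,1) z \<le> 0} \<inter> {z. inner (1,0) z \<le> 1}"
    by (auto simp: triangle_def inner_prod_def)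
  show "convex triangle" unfolding eq by (intro convex_Int convex_halfspace_le)
  show "closed triangle" unfolding eq by (intro closed_Int closed_halfspace_le)
qed (auto simp: triangle_def)

lemma corner_in_simplex: "z \<in> triangle \<Longrightarrow> corner z \<in> standard_simplex 2"
  by (cases z) (auto simp: standard_simplex_2_iff corner_def triangle_def)

lemma simplex_2_eq_tri:
  assumes "cs_simplex 2 X \<tau>"
  shows "\<tau> = tri (\<tau> \<circ> corner) (0,0) (1,0) (1,1)"
proof
  fix t
  show "\<tau> t = tri (\<tau> \<circ> corner) (0,0) (1,0) (1,1) t"
  proof (cases "t \<in> standard_simplex 2")
    case True
    then have "corner (t 1 + t 2, t 2) = t"
      unfolding standard_simplex_2_iff
      by (auto simp: corner_def fun_eq_iff)
    then show ?thesis using True by (simp add: tri_def)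
  next
    case False
    then show ?thesis
      using assms by (auto simp: cs_simplex_def tri_def extensional_def)
  qed
qed

lemma continuous_into_corner:
  assumes "cs_simplex 2 X \<tau>"
  shows "continuous_into triangle X (\<tau> \<circ> corner)"
proof (rule cs_continuous_compose)
  show "cs_continuous (cspace_of_topology (simplex_topology 2)) X \<tau>"
    using assms by (simp add: cs_simplex_def)
  have "continuous_on triangle (\<lambda>z. corner z i)" for i
    unfolding corner_def case_prod_unfold
    by (cases "i = 0"; cases "i = 1"; cases "i = 2") (auto intro!: continuous_intros)
  then show "cs_continuous (cspace_of_topology (top_of_set triangle)) (cspace_of_topology (simplex_topology 2)) corner"
    unfolding cs_continuous_of_topology
    by (intro continuous_map_into_simplex) (simp_all add: corner_in_simplex)
qed

lemma boundary_simplex_2: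
  assumes "cs_simplex 2 X \<tau>"
  shows "chain_boundary 2 (frag_of \<tau>) =
     frag_of (seg (\<tau> \<circ> corner) (1,0) (1,1)) - frag_of (seg (\<tau> \<circ> corner) (0,0) (1,1))
       + frag_of (seg (\<tau> \<circ> corner) (0,0) (1,0))"
proof -
  have "chain_boundary 2 (frag_of \<tau>) = chain_boundary 2 (frag_of (tri (\<tau> \<circ> corner) (0,0) (1,0) (1,1)))"
    by (rule arg_cong[where f = "\<lambda>\<tau>. chain_boundary 2 (frag_of \<tau>)"]) (rule simplex_2_eq_tri[OF assms])
  then show ?thesis by (simp only: chain_boundary_2 singular_face_tri)
qed

lemma cs_boundaries_1_induct [consumes 1, case_names zero one diff]:
  assumes "b \<in> cs_boundaries 1 X"
    and zero: "P 0" and one: "\<And>\<tau>. cs_simplex 2 X \<tau> \<Longrightarrow> P (chain_boundary 2 (frag_of \<tau>))"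
    and diff: "\<And>a b. P a \<Longrightarrow> P b \<Longrightarrow> P (a - b)"
  shows "P b"
proof -
  obtain c where c: "c \<in> carrier (cs_chain_group 2 X)" "b = chain_boundary 2 c"
    using assms(1) by (auto simp: cs_boundaries_def numeral_2_eq_2)
  from c(1) have "P (chain_boundary 2 c)"
    by (induction rule: cs_chain_induct) (auto simp: zero one diff chain_boundary_diff)
  then show ?thesis by (simp add: c)
qed

lemma cs_cycles_diff:
  assumes "a \<in> cs_cycles n X" "b \<in> cs_cycles n X"
  shows "a - b \<in> cs_cycles n X"
  using assms keys_diff[of a b] by (auto simp: cs_cycles_def cs_chain_group_def chain_boundary_diff)

lemma cs_cycles_add:
  assumes "a \<in> cs_cycles n X" "b \<in> cs_cycles n X"
  shows "a + b \<in> cs_cycles n X"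
  using assms keys_add[of a b] by (auto simp: cs_cycles_def cs_chain_group_def chain_boundary_add)

lemma cs_cycles_cmul:
  assumes "a \<in> cs_cycles n X"
  shows "frag_cmul m a \<in> cs_cycles n X"
  using assms keys_cmul[of m a] by (auto simp: cs_cycles_def cs_chain_group_def chain_boundary_cmul)

lemma cs_boundaries_subset_cycles: "cs_boundaries 1 X \<subseteq> cs_cycles 1 X"
proof
  fix b assume "b \<in> cs_boundaries 1 X"
  then show "b \<in> cs_cycles 1 X"
  proof (induction rule: cs_boundaries_1_induct)
    case zero
    then show ?case by (simp add: cs_cycles_def cs_chain_group_def)
  next
    case (one \<tau>)
    let ?F = "\<tau> \<circ> corner"
    have "cs_simplex 1 X (seg ?F p q)" if "p \<in> triangle" "q \<in> triangle" for p q
      using that by (intro cs_simplex_seg[OF continuous_into_corner[OF one]] triangle_geometry)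
    then have "frag_of (seg ?F p q) \<in> carrier (cs_chain_group 1 X)" if "p \<in> triangle" "q \<in> triangle" for p q
      using that by (simp add: cs_chain_group_def)
    note in_carrier = this[OF triangle_geometry(5,6)] this[OF triangle_geometry(4,6)] this[OF triangle_geometry(4,5)]
    have closed: "a - b \<in> carrier (cs_chain_group 1 X)" "a + b \<in> carrier (cs_chain_group 1 X)"
      if "a \<in> carrier (cs_chain_group 1 X)" "b \<in> carrier (cs_chain_group 1 X)" for a b
      using that keys_add[of a b] keys_diff[of a b] by (auto simp: cs_chain_group_def)
    show ?case
      unfolding boundary_simplex_2[OF one] cs_cycles_def mem_Collect_eq chain_boundary_diff
        chain_boundary_add chain_boundary_seg
      by (intro conjI closed in_carrier) simp
  next
    case (diff a b)
    then show ?case by (rule cs_cycles_diff)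
  qed
qed

text \<open>The additive extension of a real-valued function from generators to a free abelian group; the
codomain is not itself free, so that \<^const>\<open>frag_extend\<close> does not apply.\<close>

definition frag_eval :: "('a \<Rightarrow> real) \<Rightarrow> ('a \<Rightarrow>\<^sub>0 int) \<Rightarrow> real" where
  "frag_eval w c = (\<Sum>x\<in>Poly_Mapping.keys c. of_int (Poly_Mapping.lookup c x) * w x)"

lemma frag_eval_superset:
  assumes "finite S" "Poly_Mapping.keys c \<subseteq> S"
  shows "frag_eval w c = (\<Sum>x\<in>S. of_int (Poly_Mapping.lookup c x) * w x)"
  unfolding frag_eval_def using assms by (intro sum.mono_neutral_left) (auto simp: in_keys_iff)

lemma frag_eval_of [simp]: "frag_eval w (frag_of x) = w x"
  by (simp add: frag_eval_def)

lemma frag_eval_0 [simp]: "frag_eval w 0 = 0"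
  by (simp add: frag_eval_def)

lemma frag_eval_add: "frag_eval w (a + b) = frag_eval w a + frag_eval w b"
  and frag_eval_diff: "frag_eval w (a - b) = frag_eval w a - frag_eval w b"
proof -
  let ?S = "Poly_Mapping.keys a \<union> Poly_Mapping.keys b"
  have "Poly_Mapping.keys (a + b) \<subseteq> ?S" "Poly_Mapping.keys (a - b) \<subseteq> ?S"
    by (rule keys_add keys_diff)+
  then show "frag_eval w (a + b) = frag_eval w a + frag_eval w b"
    "frag_eval w (a - b) = frag_eval w a - frag_eval w b"
    by (simp_all add: frag_eval_superset[of ?S] lookup_add lookup_minus algebra_simps sum.distrib sum_subtractf)
qed

lemma frag_eval_cmul: "frag_eval w (frag_cmul n c) = of_int n * frag_eval w c"
  using frag_eval_superset[OF finite_keys keys_cmul, of w n c]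
  by (simp add: frag_eval_def sum_distrib_left mult.assoc)

lemma floor_add_of_Ints: "x \<in> \<int> \<Longrightarrow> \<lfloor>x + y\<rfloor> = \<lfloor>x\<rfloor> + \<lfloor>y\<rfloor>" for x y :: real
  by (elim Ints_cases) simp

context wedge_coordinates
begin

text \<open>The retraction of the wedge onto circle \<open>k\<close> that collapses the other circle to the basepoint,
followed by a choice of representatives.\<close>

definition coordinate :: "bool \<Rightarrow> 'p \<Rightarrow> real" where
  "coordinate k x = (if x \<in> range (iota k) then SOME u. iota k u = x else 0)"

lemma coordinate_same: "coordinate k (iota k u) - u \<in> \<int>"
proof -
  have "iota k (SOME v. iota k v = iota k u) = iota k u" by (rule someI) (rule refl)
  then have "iota k (coordinate k (iota k u)) = iota k u" by (simp only: coordinate_def rangeI if_True)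
  then show ?thesis by (simp only: iota_eq_iff if_True)
qed

lemma coordinate_other:
  assumes "l \<noteq> k"
  shows "coordinate k (iota l u) \<in> \<int>"
proof (cases "iota l u \<in> range (iota k)")
  case True
  then obtain v where "iota k v = iota l u" by (metis rangeE)
  then have "iota k (SOME v. iota k v = iota l u) = iota l u"
    by (rule someI[of "\<lambda>v. iota k v = iota l u"])
  then have "iota k (coordinate k (iota l u)) = iota l u"
    using True by (simp only: coordinate_def if_True)
  then show ?thesis using assms by (simp add: iota_eq_iff)
qed (simp add: coordinate_def)

lemma coordinate_near:
  assumes "near r iota (1/3 - r k) x y"
  shows "\<exists>n::int. \<bar>coordinate k y - coordinate k x - n\<bar> < 1/3"
proof -
  obtain l u v where uv: "x = iota l u" "y = iota l v" "\<bar>u - v\<bar> < r l + (1/3 - r k)"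
    using assms by (auto simp: near_def)
  show ?thesis
  proof (cases "l = k")
    case True
    obtain m where m: "coordinate k (iota k u) - u = of_int m"
      using coordinate_same by (rule Ints_cases)
    obtain n where n: "coordinate k (iota k v) - v = of_int n"
      using coordinate_same by (rule Ints_cases)
    have "\<bar>coordinate k (iota k v) - coordinate k (iota k u) - of_int (n - m)\<bar> < 1/3"
      unfolding of_int_diff m[symmetric] n[symmetric] using uv(3)[unfolded True] by linarith
    then show ?thesis unfolding uv True by blast
  next
    case False
    then obtain m n where "coordinate k x = of_int m" "coordinate k y = of_int n"
      using coordinate_other[OF False, of u] coordinate_other[OF False, of v] unfolding uv
      by (elim Ints_cases) blast
    then have "\<bar>coordinate k y - coordinate k x - of_int (n - m)\<bar> < 1/3" by simp
    then show ?thesis by blast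
  qed
qed

lemma small_jumps_coordinate:
  fixes D :: "'a::metric_space set"
  assumes F: "continuous_into D X F" and k: "r k < 1/3"
  shows "small_jumps D (coordinate k \<circ> F)"
  unfolding small_jumps_def
proof
  fix x assume "x \<in> D"
  moreover have "1/3 - r k > 0" using k by simp
  ultimately obtain d where "d > 0" "\<And>y. y \<in> D \<Longrightarrow> dist x y < d \<Longrightarrow> near r iota (1/3 - r k) (F x) (F y)"
    using F unfolding continuous_into_iff by meson
  then show "\<exists>d>0. \<forall>y\<in>D. dist x y < d \<longrightarrow> (\<exists>n::int. \<bar>(coordinate k \<circ> F) y - (coordinate k \<circ> F) x - n\<bar> < 1/3)"
    using coordinate_near by (intro exI[of _ d]) auto
qed

definition winding_number :: "bool \<Rightarrow> 'p chain \<Rightarrow> real" where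
  "winding_number k = frag_eval (\<lambda>\<sigma>. winding (coordinate k \<circ> \<sigma> \<circ> edge))"

lemma seg_edge: "0 \<le> s \<Longrightarrow> s \<le> 1 \<Longrightarrow> seg F p q (edge s) = F ((1 - s) *\<^sub>R p + s *\<^sub>R q)"
  using edge_in_simplex[of s] by (simp add: seg_def edge_def)

lemma winding_number_seg:
  fixes p q :: "'a::real_normed_vector"
  assumes "lifts S (coordinate k \<circ> F) G" "convex S" "p \<in> S" "q \<in> S"
  shows "winding_number k (frag_of (seg F p q)) = G q - G p"
  unfolding winding_number_def frag_eval_of
  by (rule winding_segment[OF assms]) (simp add: seg_edge)

text \<open>A lift of the whole triangle computes the winding of all three sides, and its increments along them
cancel.\<close>

lemma winding_number_boundary:
  assumes b: "b \<in> cs_boundaries 1 X" and k: "r k < 1/3"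
  shows "winding_number k b = 0"
  using b
proof (induction rule: cs_boundaries_1_induct)
  case zero
  then show ?case by (simp add: winding_number_def)
next
  case (one \<tau>)
  let ?F = "\<tau> \<circ> corner"
  obtain G where G: "lifts triangle (coordinate k \<circ> ?F) G"
    using lifts_exists_plane[OF small_jumps_coordinate[OF continuous_into_corner[OF one] k]]
      triangle_geometry by blast
  have "winding_number k (frag_of (seg ?F p q)) = G q - G p" if "p \<in> triangle" "q \<in> triangle" for p q
    using that by (intro winding_number_seg[OF G triangle_geometry(1)])
  then show ?case
    using triangle_geometry(4-6) unfolding boundary_simplex_2[OF one]
    by (simp add: winding_number_def frag_eval_add frag_eval_diff)
next
  case (diff a b)
  then show ?case by (simp add: winding_number_def frag_eval_diff)
qed

lemma winding_number_loop: "winding_number k (loop l) = (if k = l then 1 else 0)"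
proof (cases "k = l")
  case True
  have "lifts UNIV (coordinate k \<circ> iota k) (\<lambda>u. u)"
    unfolding lifts_def
  proof (intro conjI ballI)
    fix x :: real
    show "x - (coordinate k \<circ> iota k) x \<in> \<int>"
      using Ints_minus[OF coordinate_same[of k x]] by simp
    show "\<exists>d>0. \<forall>y\<in>UNIV. dist x y < d \<longrightarrow> \<bar>y - x\<bar> < 1/3"
      by (intro exI[of _ "1/3"] conjI ballI impI) (unfold dist_real_def, linarith+)
  qed
  from winding_number_seg[OF this, of 0 1] show ?thesis
    by (simp add: True loop_def arc_def)
next
  case False
  have "lifts UNIV (coordinate k \<circ> iota l) (\<lambda>_. 0)"
    unfolding lifts_def
  proof (intro conjI ballI)
    show "0 - (coordinate k \<circ> iota l) x \<in> \<int>" for x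
      using coordinate_other[of l k x] False by simp
  qed (auto intro: exI[of _ 1])
  from winding_number_seg[OF this, of 0 1] show ?thesis
    using False by (simp add: loop_def arc_def)
qed


section \<open>The first homology of the wedge\<close>

lemma loop_cycle: "loop k \<in> cs_cycles 1 X"
proof -
  have "iota k 1 = iota k 0" by (simp add: iota_eq_iff)
  then have "chain_boundary 1 (loop k) = 0"
    by (simp only: loop_def arc_def chain_boundary_seg diff_self)
  moreover have "cs_simplex 1 X (seg (iota k) 0 1)"
    by (intro cs_simplex_seg[OF continuous_into_iota]) auto
  ultimately show ?thesis by (simp add: cs_cycles_def cs_chain_group_def loop_def arc_def)
qed

lemma winding_number_linear:
  "winding_number k (a + b) = winding_number k a + winding_number k b"
  "winding_number k (a - b) = winding_number k a - winding_number k b"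
  "winding_number k (frag_cmul n a) = of_int n * winding_number k a"
  by (simp_all add: winding_number_def frag_eval_add frag_eval_diff frag_eval_cmul)

text \<open>The coefficients of the loops of small radius are recovered by the winding numbers.\<close>

lemma cycle_decomposition:
  assumes c: "c \<in> cs_cycles 1 X" and gap: "\<And>k. r k < 1/3 \<or> 1/2 \<le> r k"
  obtains m where "c - frag_cmul (m True) (loop True) - frag_cmul (m False) (loop False) \<in> cs_boundaries 1 X"
    "\<And>k. r k < 1/3 \<Longrightarrow> winding_number k c = of_int (m k)"
proof -
  obtain a b where ab: "c - frag_cmul a (loop True) - frag_cmul b (loop False) \<in> cs_boundaries 1 X"
    using cycle_in_loop_span[OF c gap] by (auto simp: loop_span_def)
  have "winding_number k c = of_int (if k then a else b)" if "r k < 1/3" for k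
    using winding_number_boundary[OF ab that]
    by (cases k) (simp_all add: winding_number_linear winding_number_loop)
  then show ?thesis using that[of "\<lambda>k. if k then a else b"] ab by simp
qed

lemma cycle_boundary_iff:
  assumes c: "c \<in> cs_cycles 1 X" and gap: "\<And>k. r k < 1/3 \<or> 1/2 \<le> r k"
  shows "c \<in> cs_boundaries 1 X \<longleftrightarrow> (\<forall>k. r k < 1/3 \<longrightarrow> winding_number k c = 0)"
proof
  assume R: "\<forall>k. r k < 1/3 \<longrightarrow> winding_number k c = 0"
  obtain m where m: "c - frag_cmul (m True) (loop True) - frag_cmul (m False) (loop False) \<in> cs_boundaries 1 X"
    "\<And>k. r k < 1/3 \<Longrightarrow> winding_number k c = of_int (m k)"
    using cycle_decomposition[OF c gap] by blast
  have mb: "frag_cmul (m k) (loop k) \<in> cs_boundaries 1 X" for k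
  proof (cases "r k < 1/3")
    case True
    then show ?thesis using m(2)[of k] R by (simp add: cs_boundaries_0)
  next
    case False
    then have "loop k \<in> cs_boundaries 1 X" using gap[of k] loop_boundary_of_large_radius by blast
    then show ?thesis by (rule cs_boundaries_cmul)
  qed
  have "(c - frag_cmul (m True) (loop True) - frag_cmul (m False) (loop False))
      + frag_cmul (m False) (loop False) + frag_cmul (m True) (loop True) \<in> cs_boundaries 1 X"
    by (intro cs_boundaries_add m(1) mb)
  then show "c \<in> cs_boundaries 1 X" by simp
qed (use winding_number_boundary in blast)

lemma winding_number_Ints:
  assumes "c \<in> cs_cycles 1 X" "\<And>k. r k < 1/3 \<or> 1/2 \<le> r k" "r k < 1/3"
  shows "winding_number k c \<in> \<int>"
  using cycle_decomposition[OF assms(1,2)] assms(3) by (metis Ints_of_int)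

lemma homology_two_small_radii:
  assumes small: "\<And>k. r k < 1/3"
  shows "cs_homology_group 1 X \<cong> integer_group \<times>\<times> integer_group"
proof (rule cs_homology_group_iso(1)[where \<phi> = "\<lambda>c. (\<lfloor>winding_number True c\<rfloor>, \<lfloor>winding_number False c\<rfloor>)"])
  have Z: "winding_number k c \<in> \<int>" if "c \<in> cs_cycles 1 X" for k c
    using that small by (intro winding_number_Ints) auto
  let ?\<phi> = "\<lambda>c. (\<lfloor>winding_number True c\<rfloor>, \<lfloor>winding_number False c\<rfloor>)"
  show "group (integer_group \<times>\<times> integer_group)" by (intro DirProd_group) auto
  show "?\<phi> (c + d) = ?\<phi> c \<otimes>\<^bsub>integer_group \<times>\<times> integer_group\<^esub> ?\<phi> d"
    if "c \<in> cs_cycles 1 X" "d \<in> cs_cycles 1 X" for c d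
    using Z[OF that(1)] by (simp add: winding_number_linear floor_add_of_Ints)
  show "?\<phi> c = \<one>\<^bsub>integer_group \<times>\<times> integer_group\<^esub> \<longleftrightarrow> c \<in> cs_boundaries 1 X" if c: "c \<in> cs_cycles 1 X" for c
  proof -
    have "\<lfloor>winding_number k c\<rfloor> = 0 \<longleftrightarrow> winding_number k c = 0" for k
      using Z[OF c, of k] by (auto elim!: Ints_cases)
    then show ?thesis
      using cycle_boundary_iff[OF c] small by (auto simp: all_bool_eq)
  qed
  show "?\<phi> ` cs_cycles 1 X = carrier (integer_group \<times>\<times> integer_group)"
  proof -
    have "(m, n) \<in> ?\<phi> ` cs_cycles 1 X" for m n
      by (rule image_eqI[of _ _ "frag_cmul m (loop True) + frag_cmul n (loop False)"])
         (auto simp del: One_nat_def simp: winding_number_linear winding_number_loop intro!: cs_cycles_add cs_cycles_cmul loop_cycle)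
    then show ?thesis by auto
  qed
qed (rule cs_boundaries_subset_cycles)

lemma homology_one_small_radius:
  assumes "r k < 1/3" "1/2 \<le> r (\<not> k)"
  shows "cs_homology_group 1 X \<cong> integer_group"
proof (rule cs_homology_group_iso(1)[where \<phi> = "\<lambda>c. \<lfloor>winding_number k c\<rfloor>"])
  have gap: "r l < 1/3 \<or> 1/2 \<le> r l" for l using assms by (cases "l = k") auto
  have Z: "winding_number k c \<in> \<int>" if "c \<in> cs_cycles 1 X" for c
    using that gap assms(1) by (intro winding_number_Ints) auto
  let ?\<phi> = "\<lambda>c. \<lfloor>winding_number k c\<rfloor>"
  show "?\<phi> (c + d) = ?\<phi> c \<otimes>\<^bsub>integer_group\<^esub> ?\<phi> d"
    if "c \<in> cs_cycles 1 X" "d \<in> cs_cycles 1 X" for c d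
    using Z[OF that(1)] by (simp add: winding_number_linear floor_add_of_Ints)
  show "?\<phi> c = \<one>\<^bsub>integer_group\<^esub> \<longleftrightarrow> c \<in> cs_boundaries 1 X" if c: "c \<in> cs_cycles 1 X" for c
  proof -
    have "\<lfloor>winding_number k c\<rfloor> = 0 \<longleftrightarrow> winding_number k c = 0"
      using Z[OF c] by (auto elim!: Ints_cases)
    moreover have "r l < 1/3 \<longleftrightarrow> l = k" for l using assms by (cases "l = k") auto
    ultimately show ?thesis
      using cycle_boundary_iff[OF c gap] by simp
  qed
  show "?\<phi> ` cs_cycles 1 X = carrier integer_group"
  proof -
    have "n \<in> ?\<phi> ` cs_cycles 1 X" for n
      by (rule image_eqI[of _ _ "frag_cmul n (loop k)"])
         (auto simp del: One_nat_def simp: winding_number_linear winding_number_loop intro!: cs_cycles_cmul loop_cycle)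
    then show ?thesis by auto
  qed
qed (simp_all only: cs_boundaries_subset_cycles group_integer_group)

lemma homology_no_small_radius:
  assumes large: "\<And>k. 1/2 \<le> r k"
  shows "trivial_group (cs_homology_group 1 X)"
proof -
  have "\<not> r k < 1/3" for k using large[of k] by linarith
  then have ker: "0 = \<one>\<^bsub>singleton_group (0::int)\<^esub> \<longleftrightarrow> c \<in> cs_boundaries 1 X" if "c \<in> cs_cycles 1 X" for c
    using cycle_boundary_iff[OF that] large by (simp add: singleton_group_def)
  have hom: "0 = 0 \<otimes>\<^bsub>singleton_group (0::int)\<^esub> 0"
    by (simp add: singleton_group_def)
  have onto: "(\<lambda>_. 0) ` cs_cycles 1 X = carrier (singleton_group (0::int))"
    using loop_cycle by auto
  note iso = cs_homology_group_iso[of "singleton_group (0::int)" 1 X "\<lambda>_. 0",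
      OF singleton_group hom onto ker cs_boundaries_subset_cycles]
  show ?thesis
    using isomorphic_group_triviality[OF iso singleton_group] by simp
qed

end


section \<open>The wedge of two circles in coordinates\<close>

text \<open>The class \<open>u + \<int>\<close> as a point of the circle.\<close>

definition coset :: "real \<Rightarrow> real set" where
  "coset u = {(x, y). x - y \<in> \<int>} `` {u}"

lemma mem_coset: "v \<in> coset u \<longleftrightarrow> u - v \<in> \<int>"
  by (simp add: coset_def)

lemma mem_coset_sym: "v \<in> coset u \<longleftrightarrow> v - u \<in> \<int>"
  using Ints_minus[of "u - v"] Ints_minus[of "v - u"] by (auto simp: mem_coset)

lemma coset_eq_iff: "coset u = coset v \<longleftrightarrow> u - v \<in> \<int>"
proof
  assume "coset u = coset v"
  moreover have "v \<in> coset v" by (simp add: mem_coset)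
  ultimately show "u - v \<in> \<int>" using mem_coset by blast
next
  assume uv: "u - v \<in> \<int>"
  show "coset u = coset v"
  proof (rule Set.set_eqI)
    fix w
    show "w \<in> coset u \<longleftrightarrow> w \<in> coset v"
      using Ints_add[OF uv, of "v - w"] Ints_diff[of "u - w" "u - v"] uv by (auto simp: mem_coset)
  qed
qed

lemma circle_eq: "circle = range coset"
  by (auto simp: circle_def quotient_def coset_def)

lemma setdist_coset_less_iff:
  "setdist (coset u) (coset v) < d \<longleftrightarrow> (\<exists>w. w - v \<in> \<int> \<and> \<bar>u - w\<bar> < d)"
proof
  assume L: "setdist (coset u) (coset v) < d"
  have "u \<in> coset u" "v \<in> coset v" by (auto simp: mem_coset)
  then obtain x y where xy: "x \<in> coset u" "y \<in> coset v" "dist x y < d"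
    using setdist_ltE[OF L] by blast
  have "(u - x) + (y - v) \<in> \<int>"
    by (rule Ints_add[OF mem_coset[THEN iffD1, OF xy(1)] mem_coset_sym[THEN iffD1, OF xy(2)]])
  then show "\<exists>w. w - v \<in> \<int> \<and> \<bar>u - w\<bar> < d"
    using xy(3) by (intro exI[of _ "u - x + y"]) (auto simp: dist_real_def algebra_simps)
next
  assume "\<exists>w. w - v \<in> \<int> \<and> \<bar>u - w\<bar> < d"
  then obtain w where w: "w - v \<in> \<int>" "\<bar>u - w\<bar> < d" by blast
  then have "setdist (coset u) (coset v) \<le> dist u w"
    by (intro setdist_le_dist mem_coset_sym[THEN iffD2]) simp_all
  then show "setdist (coset u) (coset v) < d" using w(2) by (simp add: dist_real_def)
qed

lemma circle_closure_iff:
  assumes "A \<subseteq> circle"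
  shows "coset u \<in> circle_closure r A \<longleftrightarrow> (\<forall>e>0. \<exists>v. coset v \<in> A \<and> \<bar>u - v\<bar> < r + e)"
proof (cases "A = {}")
  case True
  then show ?thesis by (auto simp: circle_closure_def intro: zero_less_one)
next
  case False
  have bdd: "bdd_below ((\<lambda>y. setdist (coset u) y) ` A)"
    by (rule bdd_belowI[of _ 0]) (auto simp: setdist_pos_le)
  have "coset u \<in> circle_closure r A \<longleftrightarrow> (INF y\<in>A. setdist (coset u) y) \<le> r"
    using False by (simp add: circle_closure_def circle_eq)
  also have "\<dots> \<longleftrightarrow> (\<forall>e>0. (INF y\<in>A. setdist (coset u) y) < r + e)"
    by (metis add.commute add_strict_increasing field_le_epsilon less_eq_real_def)
  also have "\<dots> \<longleftrightarrow> (\<forall>e>0. \<exists>y\<in>A. setdist (coset u) y < r + e)"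
    using cINF_less_iff[OF False bdd] by simp
  also have "\<dots> \<longleftrightarrow> (\<forall>e>0. \<exists>v. coset v \<in> A \<and> \<bar>u - v\<bar> < r + e)"
  proof -
    have "(\<exists>y\<in>A. setdist (coset u) y < d) \<longleftrightarrow> (\<exists>v. coset v \<in> A \<and> \<bar>u - v\<bar> < d)" for d
    proof
      assume "\<exists>y\<in>A. setdist (coset u) y < d"
      then obtain v where "coset v \<in> A" "setdist (coset u) (coset v) < d"
        using assms by (auto simp: circle_eq)
      then show "\<exists>v. coset v \<in> A \<and> \<bar>u - v\<bar> < d"
        using setdist_coset_less_iff coset_eq_iff by metis
    next
      assume "\<exists>v. coset v \<in> A \<and> \<bar>u - v\<bar> < d"
      then show "\<exists>y\<in>A. setdist (coset u) y < d"
        using setdist_coset_less_iff by (metis Ints_0 diff_self)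
    qed
    then show ?thesis by simp
  qed
  finally show ?thesis .
qed

text \<open>The parameters of the summands are shifted by representatives \<open>a1\<close>, \<open>a2\<close> of the basepoints, so that
the basepoint has parameter \<open>0\<close> on both circles.\<close>

definition summand_point :: "real \<Rightarrow> real \<Rightarrow> bool \<Rightarrow> real \<Rightarrow> real set + real set" where
  "summand_point a1 a2 k u = (if k then Inl (coset (a1 + u)) else Inr (coset (a2 + u)))"

text \<open>A point lies in the closure of \<open>A\<close> when one of its representatives lies in the closure of the
preimage of \<open>A\<close>.  Only the basepoint has several representatives that matter, one on each circle.\<close>

lemma wedge_coordinates_wedge:
  fixes r1 r2 a1 a2 :: real
  assumes r: "r1 > 0" "r2 > 0"
  defines "X \<equiv> cs_wedge (circle_cspace r1) (coset a1) (circle_cspace r2) (coset a2)"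
    and "R \<equiv> wedge_rel (circle_cspace r1) (coset a1) (circle_cspace r2) (coset a2)"
  shows "wedge_coordinates X (\<lambda>k. if k then r1 else r2) (\<lambda>k u. R `` {summand_point a1 a2 k u})"
proof -
  let ?r = "\<lambda>k. if k then r1 else r2"
  define Y where "Y = cs_sum (circle_cspace r1) (circle_cspace r2)"
  define p where "p = summand_point a1 a2"
  define q where "q z = R `` {z}" for z
  have onto: "\<exists>u. coset v = coset (a + u)" for v a
    by (intro exI[of _ "v - a"]) simp
  have pts: "points Y = range (p True) \<union> range (p False)"
    using onto unfolding Y_def p_def summand_point_def
    by (auto simp: cs_sum_def circle_cspace_def circle_eq image_iff)
  have equiv: "equiv (points Y) R"
    unfolding Y_def R_def using equiv_wedge_rel[of "coset a1" "circle_cspace r1" "coset a2" "circle_cspace r2"]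
    by (simp add: cs_sum_def circle_cspace_def circle_eq)
  have p_in: "p k u \<in> points Y" for k u using pts by (cases k) auto
  have base: "coset a = coset (a + u) \<longleftrightarrow> u \<in> \<int>" for a u
    using Ints_minus[of u] Ints_minus[of "- u"] by (auto simp: coset_eq_iff)
  have R_iff: "(p k u, p l v) \<in> R \<longleftrightarrow> (if k = l then u - v \<in> \<int> else u \<in> \<int> \<and> v \<in> \<int>)" for k l u v
  proof -
    have "(p k u, p l v) \<in> R \<longleftrightarrow> (if k = l then p k u = p l v else p k u = p k 0 \<and> p l v = p l 0)"
      using p_in[of k u] unfolding R_def wedge_rel_def Y_def
      by (cases k; cases l) (auto simp: p_def summand_point_def cs_sum_def)
    then show ?thesis
      using base by (cases k; cases l) (auto simp: p_def summand_point_def coset_eq_iff)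
  qed
  have q_eq: "q (p k u) = q (p l v) \<longleftrightarrow> (if k = l then u - v \<in> \<int> else u \<in> \<int> \<and> v \<in> \<int>)" for k l u v
    unfolding q_def R_iff[symmetric] by (rule eq_equiv_class_iff[OF equiv p_in p_in])
  have X: "X = cs_quotient Y R" by (simp add: X_def cs_wedge_def Y_def R_def)
  have clos_sum: "p k u \<in> clos Y B \<longleftrightarrow> (\<forall>e>0. \<exists>v. p k v \<in> B \<and> \<bar>u - v\<bar> < ?r k + e)"
    if B: "B \<subseteq> points Y" for k u B
  proof -
    have shift: "(\<exists>v. coset v \<in> A \<and> \<bar>(a + u) - v\<bar> < d) \<longleftrightarrow> (\<exists>v. coset (a + v) \<in> A \<and> \<bar>u - v\<bar> < d)" for a A d
    proof
      assume "\<exists>v. coset v \<in> A \<and> \<bar>(a + u) - v\<bar> < d"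
      then obtain v where "coset v \<in> A" "\<bar>(a + u) - v\<bar> < d" by blast
      then show "\<exists>v. coset (a + v) \<in> A \<and> \<bar>u - v\<bar> < d"
        by (intro exI[of _ "v - a"]) (simp add: algebra_simps)
    next
      assume "\<exists>v. coset (a + v) \<in> A \<and> \<bar>u - v\<bar> < d"
      then obtain v where "coset (a + v) \<in> A" "\<bar>u - v\<bar> < d" by blast
      then show "\<exists>v. coset v \<in> A \<and> \<bar>(a + u) - v\<bar> < d"
        by (intro exI[of _ "a + v"]) simp
    qed
    have sub: "Inl -` B \<subseteq> circle" "Inr -` B \<subseteq> circle"
      using B by (auto simp: Y_def cs_sum_def circle_cspace_def)
    show ?thesis
    proof (cases k)
      case True
      then have "p k u \<in> clos Y B \<longleftrightarrow> coset (a1 + u) \<in> circle_closure r1 (Inl -` B)"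
        by (auto simp: Y_def cs_sum_def circle_cspace_def p_def summand_point_def)
      then show ?thesis
        using True unfolding circle_closure_iff[OF sub(1)] shift by (simp add: p_def summand_point_def)
    next
      case False
      then have "p k u \<in> clos Y B \<longleftrightarrow> coset (a2 + u) \<in> circle_closure r2 (Inr -` B)"
        by (auto simp: Y_def cs_sum_def circle_cspace_def p_def summand_point_def)
      then show ?thesis
        using False unfolding circle_closure_iff[OF sub(2)] shift by (simp add: p_def summand_point_def)
    qed
  qed
  have clos_X: "clos X A = {x. \<forall>e>0. \<exists>y\<in>A. near ?r (\<lambda>k u. q (p k u)) e x y}" for A
  proof (rule Set.set_eqI)
    fix x
    define B where "B = {z \<in> points Y. q z \<in> A}"
    have B: "B \<subseteq> points Y" by (auto simp: B_def)
    have mem_B: "p k v \<in> B \<longleftrightarrow> q (p k v) \<in> A" for k v using p_in by (simp add: B_def)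
    have clos_B: "z \<in> range (p True) \<union> range (p False)" if "z \<in> clos Y B" for z
    proof -
      have "clos Y B \<subseteq> points Y"
        using B r closure_space_sum[OF closure_space_circle closure_space_circle, of r1 r2]
        unfolding closure_space_def Y_def by simp
      then show ?thesis using that pts by blast
    qed
    have "x \<in> clos X A \<longleftrightarrow> x \<in> q ` clos Y B"
      by (simp add: X cs_quotient_def q_def B_def)
    also have "\<dots> \<longleftrightarrow> (\<exists>k u. x = q (p k u) \<and> p k u \<in> clos Y B)"
      using clos_B by (auto simp: image_iff) blast+
    also have "\<dots> \<longleftrightarrow> (\<exists>k u. x = q (p k u) \<and> (\<forall>e>0. \<exists>v. q (p k v) \<in> A \<and> \<bar>u - v\<bar> < ?r k + e))"
      by (simp only: clos_sum[OF B] mem_B)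
    also have "\<dots> \<longleftrightarrow> (\<forall>e>0. \<exists>y\<in>A. near ?r (\<lambda>k u. q (p k u)) e x y)"
    proof
      assume "\<exists>k u. x = q (p k u) \<and> (\<forall>e>0. \<exists>v. q (p k v) \<in> A \<and> \<bar>u - v\<bar> < ?r k + e)"
      then show "\<forall>e>0. \<exists>y\<in>A. near ?r (\<lambda>k u. q (p k u)) e x y"
        unfolding near_def by blast
    next
      assume R: "\<forall>e>0. \<exists>y\<in>A. near ?r (\<lambda>k u. q (p k u)) e x y"
      \<comment> \<open>The circle on which the nearby points of \<open>A\<close> are found may depend on \<open>e\<close>; as closeness is monotone in \<open>e\<close>, one of the two circles serves every \<open>e\<close>.\<close>
      define good where "good k e \<longleftrightarrow> (\<exists>u v. x = q (p k u) \<and> q (p k v) \<in> A \<and> \<bar>u - v\<bar> < ?r k + e)" for k e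
      have good_mono: "good k d" if "good k e" "e \<le> d" for k e d
        using that unfolding good_def by force
      have "good True e \<or> good False e" if "e > 0" for e
        using R that unfolding good_def near_def by (metis (full_types))
      then have "(\<forall>e>0. good True e) \<or> (\<forall>e>0. good False e)"
        using good_mono by (metis min.cobounded1 min.cobounded2 min_less_iff_conj)
      then obtain k where k: "\<And>e. e > 0 \<Longrightarrow> good k e" by blast
      then obtain u where u: "x = q (p k u)" unfolding good_def using zero_less_one by blast
      have "\<exists>v. q (p k v) \<in> A \<and> \<bar>u - v\<bar> < ?r k + e" if e: "e > 0" for e
      proof -
        obtain u' v where uv: "x = q (p k u')" "q (p k v) \<in> A" "\<bar>u' - v\<bar> < ?r k + e"
          using k[OF e] by (auto simp: good_def)
        have "u - u' \<in> \<int>" using u uv(1) q_eq[of k u k u'] by simp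
        then have "q (p k (v + (u - u'))) = q (p k v)" by (simp add: q_eq)
        then show ?thesis using uv by (intro exI[of _ "v + (u - u')"]) (auto simp: algebra_simps)
      qed
      then show "\<exists>k u. x = q (p k u) \<and> (\<forall>e>0. \<exists>v. q (p k v) \<in> A \<and> \<bar>u - v\<bar> < ?r k + e)"
        using u by blast
    qed
    finally show "x \<in> clos X A \<longleftrightarrow> x \<in> {x. \<forall>e>0. \<exists>y\<in>A. near ?r (\<lambda>k u. q (p k u)) e x y}" by simp
  qed
  have "wedge_coordinates X ?r (\<lambda>k u. q (p k u))"
  proof
    show "0 < ?r k" for k using r by simp
    show "points X = (\<Union>k. range (\<lambda>u. q (p k u)))"
    proof -
      have "points X = q ` points Y" by (auto simp: X cs_quotient_def q_def quotient_def)
      also have "\<dots> = (\<Union>k. range (\<lambda>u. q (p k u)))" by (auto simp: pts UNIV_bool)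
      finally show ?thesis .
    qed
  qed (use q_eq clos_X in auto)
  then show ?thesis by (simp only: q_def p_def)
qed

theorem theorem5p9:
  fixes r1 r2 :: real and b1 b2 :: "real set"
  assumes "r1 > 0" and "r2 > 0"
    and "b1 \<in> circle" and "b2 \<in> circle"
  defines "X \<equiv> cs_wedge (circle_cspace r1) b1 (circle_cspace r2) b2"
  shows "(r1 < 1/3 \<and> r2 < 1/3 \<longrightarrow>
            cs_homology_group 1 X \<cong> integer_group \<times>\<times> integer_group) \<and>
         (r1 < 1/3 \<and> r2 \<ge> 1/2 \<or> r2 < 1/3 \<and> r1 \<ge> 1/2 \<longrightarrow>
            cs_homology_group 1 X \<cong> integer_group) \<and>
         (r1 \<ge> 1/2 \<and> r2 \<ge> 1/2 \<longrightarrow> trivial_group (cs_homology_group 1 X))"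
proof -
  obtain a1 a2 where a: "b1 = coset a1" "b2 = coset a2"
    using assms(3,4) by (auto simp: circle_eq)
  define R where "R = wedge_rel (circle_cspace r1) (coset a1) (circle_cspace r2) (coset a2)"
  interpret wedge_coordinates X "\<lambda>k. if k then r1 else r2" "\<lambda>k u. R `` {summand_point a1 a2 k u}"
    unfolding X_def a R_def by (rule wedge_coordinates_wedge[OF assms(1,2)])
  show ?thesis
    using homology_two_small_radii homology_one_small_radius[of True]
      homology_one_small_radius[of False] homology_no_small_radius by simp
qed

end
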